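(* The space of ends functor $\mathcal E:\mathrm{mCoarse}\to\mathrm{Unif}$, from the category of metric spaces and coarse maps modulo closeness to the category of uniform spaces and uniformly continuous maps, preserves finite coproducts.
   Context: Metrics are finite-valued. Let $(X,d)$ be a metric space. A subset $E\subseteq X\times X$ is an entourage of $X$ if $\sup_{(x,y)\in E}d(x,y)<\infty$; $B\subseteq X$ is bounded if $B\times B$ is an entourage. A subset $C\subseteq X\times X$ is a coentourage if every sequence $(x_i,y_i)_i$ in $C$ is either bounded (both $(x_i)_i$ and $(y_i)_i$ are bounded) or the set of values $d(x_i,y_i)$ is unbounded; equivalently, for every entourage $E$ there is a bounded set $B$ with $E\cap C\subseteq B\times B$. For an entourage $E$ and $A\subseteq X$ put $E[A]=\{x\in X:\exists a\in A,\ (x,a)\in E\}$. Two subsets $A,B\subseteq X$ are close if $A\times B$ is not a coentourage. A map $f:X\to Y$ of metric spaces is coarse if $(f\times f)(E)$ is an entourage of $Y$ for every entourage $E$ of $X$, and $f^{-1}(B)$ is bounded for every bounded $B\subseteq Y$. Two maps $f,g:X\to Y$ are close if $\{(f(x),g(x)):x\in X\}$ is an entourage of $Y$. A coarse cover of $X$ is a finite family $\mathcal U=(U_i)_i$ of subsets of $X$ such that $(X\times X)\setminus\bigcup_i (U_i\times U_i)$ is a coentourage. For $S\subseteq X$ the coarse star is $\mathrm{cst}(S,\mathcal U)=\bigcup\{U_i: S \text{ is close to } U_i\}$. Let $\mathbb Z_+$ be the non-negative integers with the standard metric. The set $\mathcal E(X)$ consists of endpoints: equivalence classes $[\phi]$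 of coarse maps $\phi:\mathbb Z_+\to X$, where $\phi$ and $\psi$ are equivalent if $\phi(\mathbb Z_+)$ and $\psi(\mathbb Z_+)$ have finite Hausdorff distance. For a coarse cover $\mathcal U$ and endpoints $p=[\phi]$, $q=[\psi]$ write $q\in\mathcal U[p]$ if there is an entourage $E$ of $X$ with $\psi(\mathbb Z_+)\subseteq E[\mathrm{cst}(\phi(\mathbb Z_+),\mathcal U)]$ and $\phi(\mathbb Z_+)\subseteq E[\mathrm{cst}(\psi(\mathbb Z_+),\mathcal U)]$. The uniformity on $\mathcal E(X)$ has as base the sets $D_{\mathcal U}=\{(p,q): q\in\mathcal U[p]\}$, with $\mathcal U$ ranging over all coarse covers of $X$. On morphisms, $\mathcal E(f)([\varphi])=[f\circ\varphi]$. *)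

theory Defs
  imports "HOL-Analysis.Analysis"
begin

section \<open>Coarse geometry of metric spaces\<close>

definition entourage :: "'a metric \<Rightarrow> ('a \<times> 'a) set \<Rightarrow> bool" where
  "entourage X E \<longleftrightarrow>
     E \<subseteq> mspace X \<times> mspace X \<and> bdd_above ((\<lambda>(x, y). mdist X x y) ` E)"

definition coarse_bounded :: "'a metric \<Rightarrow> 'a set \<Rightarrow> bool" where
  "coarse_bounded X B \<longleftrightarrow> B \<subseteq> mspace X \<and> entourage X (B \<times> B)"

definition coentourage :: "'a metric \<Rightarrow> ('a \<times> 'a) set \<Rightarrow> bool" where
  "coentourage X C \<longleftrightarrow>
     C \<subseteq> mspace X \<times> mspace X \<and>
     (\<forall>x y :: nat \<Rightarrow> 'a. (\<forall>i. (x i, y i) \<in> C) \<longrightarrow>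
        (coarse_bounded X (range x) \<and> coarse_bounded X (range y)) \<or>
        \<not> bdd_above (range (\<lambda>i. mdist X (x i) (y i))))"

lemma coarse_bounded_iff:
  assumes "a \<in> mspace X"
  shows "coarse_bounded X B \<longleftrightarrow> B \<subseteq> mspace X \<and> (\<exists>R. \<forall>x\<in>B. mdist X a x \<le> R)"
proof (cases "B = {}")
  case True
  then show ?thesis by (simp add: coarse_bounded_def entourage_def)
next
  case False
  interpret Metric_space "mspace X" "mdist X" by simp
  from False obtain b where b: "b \<in> B" by blast
  show ?thesis
  proof (intro iffI conjI)
    assume bd: "coarse_bounded X B"
    then show sub: "B \<subseteq> mspace X" by (simp add: coarse_bounded_def)
    from bd have "\<exists>R. \<forall>x\<in>B. \<forall>y\<in>B. mdist X x y \<le> R"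
      by (auto simp: coarse_bounded_def entourage_def bdd_above_def)
    then obtain R where R: "\<And>x y. x \<in> B \<Longrightarrow> y \<in> B \<Longrightarrow> mdist X x y \<le> R"
      by blast
    have "mdist X a x \<le> mdist X a b + R" if "x \<in> B" for x
    proof -
      have "x \<in> mspace X" "b \<in> mspace X" using sub b that by auto
      then show ?thesis using triangle[of a b x] R[OF b that] assms by simp
    qed
    then show "\<exists>R. \<forall>x\<in>B. mdist X a x \<le> R" by blast
  next
    assume "B \<subseteq> mspace X \<and> (\<exists>R. \<forall>x\<in>B. mdist X a x \<le> R)"
    then obtain R where sub: "B \<subseteq> mspace X" and R: "\<And>x. x \<in> B \<Longrightarrow> mdist X a x \<le> R"
      by blast
    have "mdist X x y \<le> 2 * R" if "x \<in> B" "y \<in> B" for x y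
    proof -
      have "x \<in> mspace X" "y \<in> mspace X" using sub that by auto
      then show ?thesis
        using triangle[of x a y] commute[of x a] R[OF that(1)] R[OF that(2)] assms by simp
    qed
    then have "bdd_above ((\<lambda>(x, y). mdist X x y) ` (B \<times> B))"
      by (intro bdd_aboveI[where M = "2 * R"]) auto
    with sub show "coarse_bounded X B"
      by (auto simp: coarse_bounded_def entourage_def)
  qed
qed

lemma coentourage_iff:
  "coentourage X C \<longleftrightarrow>
     C \<subseteq> mspace X \<times> mspace X \<and>
     (\<forall>E. entourage X E \<longrightarrow> (\<exists>B. coarse_bounded X B \<and> E \<inter> C \<subseteq> B \<times> B))"
proof (intro iffI conjI allI impI)
  interpret Metric_space "mspace X" "mdist X" by simp
  assume C: "coentourage X C"
  then show sub: "C \<subseteq> mspace X \<times> mspace X" by (simp add: coentourage_def)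
  fix E assume E: "entourage X E"
  show "\<exists>B. coarse_bounded X B \<and> E \<inter> C \<subseteq> B \<times> B"
  proof (cases "mspace X = {}")
    case True
    with sub show ?thesis
      by (intro exI[of _ "{}"]) (auto simp: coarse_bounded_def entourage_def)
  next
    case False
    then obtain a where a: "a \<in> mspace X" by blast
    show ?thesis
    proof (rule ccontr)
      assume neg: "\<not> ?thesis"
      have "\<exists>p. p \<in> E \<inter> C \<and>
              \<not> (mdist X a (fst p) \<le> real n \<and> mdist X a (snd p) \<le> real n)" for n
      proof (rule ccontr)
        assume no: "\<not> ?thesis"
        have "coarse_bounded X {x \<in> mspace X. mdist X a x \<le> real n}"
          using a by (auto simp: coarse_bounded_iff)
        moreover have "(x, y) \<in> {x \<in> mspace X. mdist X a x \<le> real n} \<times>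
                                {x \<in> mspace X. mdist X a x \<le> real n}"
          if xy: "(x, y) \<in> E \<inter> C" for x y
        proof -
          have "x \<in> mspace X" "y \<in> mspace X" using sub xy by auto
          moreover have "mdist X a x \<le> real n \<and> mdist X a y \<le> real n"
          proof (rule ccontr)
            assume "\<not> (mdist X a x \<le> real n \<and> mdist X a y \<le> real n)"
            with xy have "(x, y) \<in> E \<inter> C \<and>
                \<not> (mdist X a (fst (x, y)) \<le> real n \<and> mdist X a (snd (x, y)) \<le> real n)"
              by (simp only: fst_conv snd_conv simp_thms)
            with no show False by (rule notE[OF _ exI])
          qed
          ultimately show ?thesis by simp
        qed
        then have "E \<inter> C \<subseteq> {x \<in> mspace X. mdist X a x \<le> real n} \<times>
                                {x \<in> mspace X. mdist X a x \<le> real n}"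
          by (rule subrelI)
        ultimately show False using neg by blast
      qed
      then have "\<exists>p. \<forall>n. p n \<in> E \<inter> C \<and>
              \<not> (mdist X a (fst (p n)) \<le> real n \<and> mdist X a (snd (p n)) \<le> real n)"
        by (intro choice allI)
      then obtain p where p: "\<And>n. p n \<in> E \<inter> C"
        and far: "\<And>n. \<not> (mdist X a (fst (p n)) \<le> real n \<and> mdist X a (snd (p n)) \<le> real n)"
        by blast
      have "bdd_above ((\<lambda>(x, y). mdist X x y) ` E)" using E by (simp add: entourage_def)
      then have "bdd_above (range (\<lambda>i. mdist X (fst (p i)) (snd (p i))))"
      proof (rule bdd_above_mono)
        have "(\<lambda>(x, y). mdist X x y) (p i) \<in> (\<lambda>(x, y). mdist X x y) ` E" for i
          using p[of i] by (intro imageI) simp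
        then show "range (\<lambda>i. mdist X (fst (p i)) (snd (p i))) \<subseteq> (\<lambda>(x, y). mdist X x y) ` E"
          by (simp add: case_prod_beta image_subset_iff)
      qed
      moreover have "\<forall>i. (fst (p i), snd (p i)) \<in> C" using p by simp
      ultimately have "coarse_bounded X (range (\<lambda>i. fst (p i))) \<and>
          coarse_bounded X (range (\<lambda>i. snd (p i)))"
        using C[unfolded coentourage_def, THEN conjunct2, rule_format,
            of "\<lambda>i. fst (p i)" "\<lambda>i. snd (p i)"] by blast
      then have "\<exists>R. \<forall>i. mdist X a (fst (p i)) \<le> R" "\<exists>S. \<forall>i. mdist X a (snd (p i)) \<le> S"
        by (simp_all add: coarse_bounded_iff[OF a])
      then obtain R S where R: "\<And>i. mdist X a (fst (p i)) \<le> R"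
        and S: "\<And>i. mdist X a (snd (p i)) \<le> S"
        by blast
      obtain n where "max R S \<le> real n" using real_arch_simple by blast
      with R[of n] S[of n] far[of n] show False by simp
    qed
  qed
next
  assume R: "C \<subseteq> mspace X \<times> mspace X \<and>
     (\<forall>E. entourage X E \<longrightarrow> (\<exists>B. coarse_bounded X B \<and> E \<inter> C \<subseteq> B \<times> B))"
  have "coarse_bounded X (range x) \<and> coarse_bounded X (range y)"
    if xy: "\<And>i. (x i, y i) \<in> C" and bd: "bdd_above (range (\<lambda>i. mdist X (x i) (y i)))"
    for x y :: "nat \<Rightarrow> 'a"
  proof -
    have "entourage X (range (\<lambda>i. (x i, y i)))"
      unfolding entourage_def image_image prod.case
    proof
      show "range (\<lambda>i. (x i, y i)) \<subseteq> mspace X \<times> mspace X"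
        using R xy by (meson image_subsetI subsetD)
    qed (rule bd)
    with R obtain B where B: "coarse_bounded X B"
      and sub: "range (\<lambda>i. (x i, y i)) \<inter> C \<subseteq> B \<times> B"
      by blast
    have "range x \<subseteq> B" "range y \<subseteq> B" using sub xy by auto
    moreover have "coarse_bounded X A" if A: "A \<subseteq> B" for A
    proof -
      have "A \<times> A \<subseteq> B \<times> B" using A by blast
      then have "(\<lambda>(x, y). mdist X x y) ` (A \<times> A) \<subseteq> (\<lambda>(x, y). mdist X x y) ` (B \<times> B)"
        by (rule image_mono)
      moreover have "bdd_above ((\<lambda>(x, y). mdist X x y) ` (B \<times> B))"
        using B by (simp add: coarse_bounded_def entourage_def)
      ultimately have "bdd_above ((\<lambda>(x, y). mdist X x y) ` (A \<times> A))"
        by (rule bdd_above_mono[rotated])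
      moreover have "A \<subseteq> mspace X" using A B by (auto simp: coarse_bounded_def)
      ultimately show ?thesis by (auto simp: coarse_bounded_def entourage_def)
    qed
    ultimately show ?thesis by blast
  qed
  then show "coentourage X C"
    unfolding coentourage_def using R[THEN conjunct1] by (intro conjI allI impI) metis+
qed

definition close_sets :: "'a metric \<Rightarrow> 'a set \<Rightarrow> 'a set \<Rightarrow> bool" where
  "close_sets X A B \<longleftrightarrow> \<not> coentourage X (A \<times> B)"

definition coarse_map :: "'a metric \<Rightarrow> 'b metric \<Rightarrow> ('a \<Rightarrow> 'b) \<Rightarrow> bool" where
  "coarse_map X Y f \<longleftrightarrow>
     f \<in> mspace X \<rightarrow> mspace Y \<and>
     (\<forall>E. entourage X E \<longrightarrow> entourage Y (map_prod f f ` E)) \<and>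
     (\<forall>B. coarse_bounded Y B \<longrightarrow> coarse_bounded X (f -` B \<inter> mspace X))"

definition close_maps :: "'a metric \<Rightarrow> 'b metric \<Rightarrow> ('a \<Rightarrow> 'b) \<Rightarrow> ('a \<Rightarrow> 'b) \<Rightarrow> bool" where
  "close_maps X Y f g \<longleftrightarrow> entourage Y ((\<lambda>x. (f x, g x)) ` mspace X)"

definition coarse_cover :: "'a metric \<Rightarrow> 'a set set \<Rightarrow> bool" where
  "coarse_cover X \<U> \<longleftrightarrow>
     finite \<U> \<and> (\<forall>U\<in>\<U>. U \<subseteq> mspace X) \<and>
     coentourage X (mspace X \<times> mspace X - (\<Union>U\<in>\<U>. U \<times> U))"

definition coarse_star :: "'a metric \<Rightarrow> 'a set \<Rightarrow> 'a set set \<Rightarrow> 'a set" where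
  "coarse_star X S \<U> = \<Union>{U \<in> \<U>. close_sets X S U}"


section \<open>The category of metric spaces and coarse maps modulo closeness\<close>

text \<open>
  Objects are metric spaces whose points lie in a given type. A morphism is a closeness class
  of coarse maps, represented by functions on the whole type; closeness only inspects their
  values on the carrier.
\<close>

definition mCoarse_hom :: "'a metric \<Rightarrow> 'b metric \<Rightarrow> ('a \<Rightarrow> 'b) set set" where
  "mCoarse_hom X Y =
     {f. coarse_map X Y f} //
     {(f, g). coarse_map X Y f \<and> coarse_map X Y g \<and> close_maps X Y f g}"

definition mCoarse_comp ::
    "'a metric \<Rightarrow> 'c metric \<Rightarrow> ('b \<Rightarrow> 'c) set \<Rightarrow> ('a \<Rightarrow> 'b) set \<Rightarrow> ('a \<Rightarrow> 'c) set" where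
  "mCoarse_comp X Z G F =
     {(f, g). coarse_map X Z f \<and> coarse_map X Z g \<and> close_maps X Z f g} ``
       {g \<circ> f |g f. g \<in> G \<and> f \<in> F}"

text \<open>
  The type \<open>'u\<close> plays the role of the universe containing the points of all metric spaces
  involved, including the test objects of the universal property.
\<close>

definition mCoarse_coproduct ::
    "'i set \<Rightarrow> ('i \<Rightarrow> 'u metric) \<Rightarrow> 'u metric \<Rightarrow> ('i \<Rightarrow> ('u \<Rightarrow> 'u) set) \<Rightarrow> bool" where
  "mCoarse_coproduct I X C \<iota> \<longleftrightarrow>
     (\<forall>i\<in>I. \<iota> i \<in> mCoarse_hom (X i) C) \<and>
     (\<forall>(Z :: 'u metric) G. (\<forall>i\<in>I. G i \<in> mCoarse_hom (X i) Z) \<longrightarrow>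
        (\<exists>!H. H \<in> mCoarse_hom C Z \<and> (\<forall>i\<in>I. mCoarse_comp (X i) Z H (\<iota> i) = G i)))"


section \<open>The category of uniform spaces and uniformly continuous maps\<close>

text \<open>A uniform space is a carrier together with its set of (uniform) entourages.\<close>

type_synonym 'a unif = "'a set \<times> ('a \<times> 'a) set set"

definition uniform_structure :: "'a unif \<Rightarrow> bool" where
  "uniform_structure U \<longleftrightarrow>
     fst U \<times> fst U \<in> snd U \<and>
     (\<forall>D\<in>snd U. Id_on (fst U) \<subseteq> D \<and> D \<subseteq> fst U \<times> fst U) \<and>
     (\<forall>D\<in>snd U. \<forall>D'. D \<subseteq> D' \<and> D' \<subseteq> fst U \<times> fst U \<longrightarrow> D' \<in> snd U) \<and>
     (\<forall>D\<in>snd U. \<forall>D'\<in>snd U. D \<inter> D' \<in> snd U) \<and>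
     (\<forall>D\<in>snd U. D\<inverse> \<in> snd U) \<and>
     (\<forall>D\<in>snd U. \<exists>D'\<in>snd U. D' O D' \<subseteq> D)"

definition Unif_hom :: "'a unif \<Rightarrow> 'b unif \<Rightarrow> ('a \<Rightarrow> 'b) set" where
  "Unif_hom U V =
     {f \<in> fst U \<rightarrow>\<^sub>E fst V.
        \<forall>D\<in>snd V. {(x, y) \<in> fst U \<times> fst U. (f x, f y) \<in> D} \<in> snd U}"

text \<open>
  The additional argument fixes the type in which the points of the test objects lie; it is
  independent of the types of the spaces in the cocone.
\<close>

definition Unif_coproduct ::
    "'v itself \<Rightarrow> 'i set \<Rightarrow> ('i \<Rightarrow> 'a unif) \<Rightarrow> 'b unif \<Rightarrow> ('i \<Rightarrow> 'a \<Rightarrow> 'b) \<Rightarrow> bool" where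
  "Unif_coproduct _ I U Q j \<longleftrightarrow>
     (\<forall>i\<in>I. uniform_structure (U i)) \<and> uniform_structure Q \<and>
     (\<forall>i\<in>I. j i \<in> Unif_hom (U i) Q) \<and>
     (\<forall>(W :: 'v unif) g. uniform_structure W \<and> (\<forall>i\<in>I. g i \<in> Unif_hom (U i) W) \<longrightarrow>
        (\<exists>!h. h \<in> Unif_hom Q W \<and> (\<forall>i\<in>I. compose (fst (U i)) h (j i) = g i)))"


section \<open>The space of ends functor\<close>

definition Z_plus :: "nat metric" where
  "Z_plus = metric (UNIV, \<lambda>m n. \<bar>real m - real n\<bar>)"

lemma mspace_Z_plus [simp]: "mspace Z_plus = UNIV"
  and mdist_Z_plus [simp]: "mdist Z_plus m n = \<bar>real m - real n\<bar>"
proof -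
  have "Metric_space UNIV (\<lambda>m n. \<bar>real m - real n\<bar>)"
    by unfold_locales auto
  then show "mspace Z_plus = UNIV" "mdist Z_plus m n = \<bar>real m - real n\<bar>"
    by (simp_all add: Z_plus_def Metric_space.mspace_metric Metric_space.mdist_metric)
qed

definition coarse_ray :: "'a metric \<Rightarrow> (nat \<Rightarrow> 'a) \<Rightarrow> bool" where
  "coarse_ray X \<phi> \<longleftrightarrow> coarse_map Z_plus X \<phi>"

definition finite_hausdorff_dist :: "'a metric \<Rightarrow> 'a set \<Rightarrow> 'a set \<Rightarrow> bool" where
  "finite_hausdorff_dist X A B \<longleftrightarrow>
     (\<exists>R. (\<forall>a\<in>A. \<exists>b\<in>B. mdist X a b \<le> R) \<and> (\<forall>b\<in>B. \<exists>a\<in>A. mdist X a b \<le> R))"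

definition end_rel :: "'a metric \<Rightarrow> ((nat \<Rightarrow> 'a) \<times> (nat \<Rightarrow> 'a)) set" where
  "end_rel X =
     {(\<phi>, \<psi>). coarse_ray X \<phi> \<and> coarse_ray X \<psi> \<and> finite_hausdorff_dist X (range \<phi>) (range \<psi>)}"

definition ends :: "'a metric \<Rightarrow> (nat \<Rightarrow> 'a) set set" where
  "ends X = {\<phi>. coarse_ray X \<phi>} // end_rel X"

text \<open>
  \<open>E\<inverse> `` A\<close> is the set of all \<open>x\<close> with \<open>(x, a) \<in> E\<close> for some \<open>a \<in> A\<close>. The
  condition below does not depend on the representatives of the two endpoints.
\<close>

definition end_entourage ::
    "'a metric \<Rightarrow> 'a set set \<Rightarrow> ((nat \<Rightarrow> 'a) set \<times> (nat \<Rightarrow> 'a) set) set" where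
  "end_entourage X \<U> =
     {(p, q). p \<in> ends X \<and> q \<in> ends X \<and>
        (\<exists>\<phi>\<in>p. \<exists>\<psi>\<in>q. \<exists>E. entourage X E \<and>
           range \<psi> \<subseteq> E\<inverse> `` coarse_star X (range \<phi>) \<U> \<and>
           range \<phi> \<subseteq> E\<inverse> `` coarse_star X (range \<psi>) \<U>)}"

definition ends_space :: "'a metric \<Rightarrow> (nat \<Rightarrow> 'a) set unif" where
  "ends_space X =
     (ends X,
      {D. D \<subseteq> ends X \<times> ends X \<and> (\<exists>\<U>. coarse_cover X \<U> \<and> end_entourage X \<U> \<subseteq> D)})"

definition ends_map ::
    "'a metric \<Rightarrow> 'b metric \<Rightarrow> ('a \<Rightarrow> 'b) set \<Rightarrow> (nat \<Rightarrow> 'a) set \<Rightarrow> (nat \<Rightarrow> 'b) set" where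
  "ends_map X Y F =
     (\<lambda>p\<in>ends X. end_rel Y `` {f \<circ> \<phi> |f \<phi>. f \<in> F \<and> \<phi> \<in> p})"

end

theory Submission
  imports Defs
begin

text \<open>
  The proof has three ingredients.

  First, the sets \<open>D_\<U>\<close> really generate a uniformity. The axiom that needs an idea is composition.
  It rests on a refinement theorem: every coarse cover \<open>\<U>\<close> has a coarse cover \<open>\<V>\<close> such that any
  point of \<open>V\<close> and any point of \<open>W\<close> lie in a common member of \<open>\<U>\<close> as soon as \<open>V, W \<in> \<V>\<close>
  are close (\<open>coarse_cover_refinement\<close>). Then the \<open>\<V>\<close>-star of anything coarsely inside the
  \<open>\<V>\<close>-star of \<open>S\<close> lies in the \<open>\<U>\<close>-star of \<open>S\<close>.

  Second, \<open>\<E>\<close> is a functor on closeness classes: coarse maps carry rays to rays, preserve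
  closeness of subsets, and pull coarse covers back to coarse covers.

  Third, finite coproducts of metric spaces can be modelled explicitly: choose base points and put
  distinct summands at distance \<open>d(x, b) + 1 + d(b', y)\<close> from each other. Points of distinct
  summands that are \<open>R\<close>-close are both within \<open>R\<close> of the base points, so outside bounded sets
  the summands do not see each other. Hence a ray eventually stays in one summand, the ends of the
  coproduct are the disjoint union of the ends of the summands, and coarse covers of the summands
  together form a coarse cover of the coproduct whose entourage of ends does not mix summands. So
  uniformly continuous maps on the spaces of ends of the summands glue.

  An arbitrary coproduct \<open>C\<close> is compared with this model \<open>Z\<close> by coarse maps \<open>h : C \<rightarrow> Z\<close> and
  \<open>k : Z \<rightarrow> C\<close> that respect the cocones; uniqueness in the universal property of \<open>C\<close> makes
  \<open>k \<circ> h\<close> close to the identity. Functoriality then transports the universal property of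
  \<open>\<E>(Z)\<close> to \<open>\<E>(C)\<close>. The model must have its points in the same type as the given spaces.
  This is possible if that type is infinite; over a finite type every space is bounded, there are
  no rays, and all spaces of ends are empty.
\<close>

section \<open>Coarse notions in terms of distances\<close>

lemma mdist_self [simp]: "x \<in> mspace X \<Longrightarrow> mdist X x x = 0"
  by simp

lemma entourage_iff:
  "entourage X E \<longleftrightarrow> E \<subseteq> mspace X \<times> mspace X \<and> (\<exists>R. \<forall>(x, y)\<in>E. mdist X x y \<le> R)"
  by (auto simp: entourage_def bdd_above_def)

lemma coarse_bounded_diameter:
  "coarse_bounded X B \<longleftrightarrow> B \<subseteq> mspace X \<and> (\<exists>R. \<forall>x\<in>B. \<forall>y\<in>B. mdist X x y \<le> R)"
  by (auto simp: coarse_bounded_def entourage_iff)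

lemma coarse_bounded_subset:
  "coarse_bounded X B \<Longrightarrow> A \<subseteq> B \<Longrightarrow> coarse_bounded X A"
  unfolding coarse_bounded_diameter by (meson subset_iff)

lemma coarse_bounded_neighbourhood:
  assumes "coarse_bounded X B" "A \<subseteq> mspace X" "\<forall>a\<in>A. \<exists>b\<in>B. mdist X a b \<le> R"
  shows "coarse_bounded X A"
proof -
  obtain S where S: "\<forall>x\<in>B. \<forall>y\<in>B. mdist X x y \<le> S" and B: "B \<subseteq> mspace X"
    using assms(1) by (auto simp: coarse_bounded_diameter)
  have "mdist X x y \<le> R + S + R" if xy: "x \<in> A" "y \<in> A" for x y
  proof -
    obtain a b where ab: "a \<in> B" "mdist X x a \<le> R" "b \<in> B" "mdist X y b \<le> R"
      using assms(3) xy by blast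
    have "mdist X x y \<le> mdist X x a + mdist X a y" "mdist X a y \<le> mdist X a b + mdist X b y"
      by (rule mdist_triangle; use ab B assms(2) xy in blast)+
    moreover have "mdist X a b \<le> S" using S ab by blast
    ultimately show ?thesis using ab by (simp add: mdist_commute[of X b])
  qed
  then show ?thesis using assms(2) unfolding coarse_bounded_diameter by blast
qed

lemma coarse_bounded_empty [simp]: "coarse_bounded X {}"
  by (simp add: coarse_bounded_diameter)

lemma coarse_bounded_Un:
  assumes "coarse_bounded X A" "coarse_bounded X B"
  shows "coarse_bounded X (A \<union> B)"
proof (cases "A = {} \<or> B = {}")
  case True
  then show ?thesis using assms by auto
next
  case False
  then obtain a b where a: "a \<in> A" and b: "b \<in> B" by blast
  then have aM: "a \<in> mspace X" and bM: "b \<in> mspace X"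
    using assms by (auto simp: coarse_bounded_def)
  obtain R S where R: "\<forall>x\<in>A. mdist X a x \<le> R" and S: "\<forall>x\<in>B. mdist X b x \<le> S"
    using coarse_bounded_iff[OF aM, of A] coarse_bounded_iff[OF bM, of B] assms by auto
  have "mdist X a x \<le> max R (mdist X a b + S)" if "x \<in> A \<union> B" for x
  proof (cases "x \<in> A")
    case True
    then show ?thesis using R by fastforce
  next
    case False
    then have x: "x \<in> B" using that by blast
    then have "mdist X a x \<le> mdist X a b + mdist X b x"
      using assms(2) aM bM by (intro mdist_triangle) (auto simp: coarse_bounded_def)
    with S x show ?thesis by fastforce
  qed
  then show ?thesis
    using assms coarse_bounded_iff[OF aM, of "A \<union> B"] by (auto simp: coarse_bounded_def)
qed

lemma coarse_bounded_UN:
  assumes "finite I" "\<And>i. i \<in> I \<Longrightarrow> coarse_bounded X (B i)"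
  shows "coarse_bounded X (\<Union>i\<in>I. B i)"
  using assms by (induction I rule: finite_induct) (auto intro: coarse_bounded_Un)

lemma coarse_bounded_finite:
  assumes "finite B" "B \<subseteq> mspace X"
  shows "coarse_bounded X B"
proof -
  have "coarse_bounded X (\<Union>b\<in>B. {b})"
    using assms by (intro coarse_bounded_UN) (auto simp: coarse_bounded_diameter)
  then show ?thesis by simp
qed

text \<open>
  One direction of the pairing suffices: if only a bounded part of \<open>A\<close> comes \<open>R\<close>-near to \<open>B\<close>, then
  the points of \<open>B\<close> that witness this are bounded as well.
\<close>

lemma close_sets_iff:
  assumes "A \<subseteq> mspace X" "B \<subseteq> mspace X"
  shows "close_sets X A B \<longleftrightarrow> (\<exists>R. \<not> coarse_bounded X {a \<in> A. \<exists>b\<in>B. mdist X a b \<le> R})"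
proof -
  have "coentourage X (A \<times> B) \<longleftrightarrow> (\<forall>R. coarse_bounded X {a \<in> A. \<exists>b\<in>B. mdist X a b \<le> R})"
    (is "?L \<longleftrightarrow> ?R")
  proof
    assume L: ?L
    show ?R
    proof
      fix R
      let ?E = "{(x, y). x \<in> mspace X \<and> y \<in> mspace X \<and> mdist X x y \<le> R}"
      have "entourage X ?E" unfolding entourage_iff by auto
      then obtain D where "coarse_bounded X D \<and> ?E \<inter> A \<times> B \<subseteq> D \<times> D"
        using L[unfolded coentourage_iff, THEN conjunct2] by meson
      then have "coarse_bounded X D" "?E \<inter> A \<times> B \<subseteq> D \<times> D" by auto
      then show "coarse_bounded X {a \<in> A. \<exists>b\<in>B. mdist X a b \<le> R}"
        using assms by (elim coarse_bounded_subset) blast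
    qed
  next
    assume R: ?R
    show ?L unfolding coentourage_iff
    proof (intro conjI allI impI)
      show "A \<times> B \<subseteq> mspace X \<times> mspace X" using assms by blast
    next
      fix E assume "entourage X E"
      then obtain r where r: "\<And>x y. (x, y) \<in> E \<Longrightarrow> mdist X x y \<le> r"
        unfolding entourage_iff by blast
      define D where "D = {a \<in> A. \<exists>b\<in>B. mdist X a b \<le> r}"
      define D' where "D' = {b \<in> B. \<exists>a\<in>D. mdist X b a \<le> r}"
      have D: "coarse_bounded X D" using R by (simp add: D_def)
      then have "coarse_bounded X D'"
        by (rule coarse_bounded_neighbourhood) (use assms in \<open>auto simp: D'_def\<close>)
      with D have "coarse_bounded X (D \<union> D')" by (rule coarse_bounded_Un)
      moreover have "E \<inter> A \<times> B \<subseteq> (D \<union> D') \<times> (D \<union> D')"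
        using r by (fastforce simp: D_def D'_def mdist_commute)
      ultimately show "\<exists>D. coarse_bounded X D \<and> E \<inter> A \<times> B \<subseteq> D \<times> D" by blast
    qed
  qed
  then show ?thesis by (simp add: close_sets_def)
qed

text \<open>
  Far out, any two \<open>R\<close>-close points share a member. This is a condition on pairs: whole \<open>R\<close>-balls
  need not lie in a single member, even far out.
\<close>

lemma coarse_cover_iff:
  "coarse_cover X \<U> \<longleftrightarrow>
     finite \<U> \<and> (\<forall>U\<in>\<U>. U \<subseteq> mspace X) \<and>
     (\<forall>R. \<exists>B. coarse_bounded X B \<and>
        (\<forall>x\<in>mspace X - B. \<forall>y\<in>mspace X. mdist X x y \<le> R \<longrightarrow> (\<exists>U\<in>\<U>. x \<in> U \<and> y \<in> U)))"
proof -
  have "coentourage X (mspace X \<times> mspace X - (\<Union>U\<in>\<U>. U \<times> U)) \<longleftrightarrow>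
    (\<forall>R. \<exists>B. coarse_bounded X B \<and>
        (\<forall>x\<in>mspace X - B. \<forall>y\<in>mspace X. mdist X x y \<le> R \<longrightarrow> (\<exists>U\<in>\<U>. x \<in> U \<and> y \<in> U)))"
    (is "?L \<longleftrightarrow> ?R")
  proof
    assume L: ?L
    show ?R
    proof
      fix R
      let ?E = "{(x, y). x \<in> mspace X \<and> y \<in> mspace X \<and> mdist X x y \<le> R}"
      have "entourage X ?E" unfolding entourage_iff by auto
      then obtain B where "coarse_bounded X B \<and>
          ?E \<inter> (mspace X \<times> mspace X - (\<Union>U\<in>\<U>. U \<times> U)) \<subseteq> B \<times> B"
        using L[unfolded coentourage_iff, THEN conjunct2] by meson
      then show "\<exists>B. coarse_bounded X B \<and>
        (\<forall>x\<in>mspace X - B. \<forall>y\<in>mspace X. mdist X x y \<le> R \<longrightarrow> (\<exists>U\<in>\<U>. x \<in> U \<and> y \<in> U))"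
        by (intro exI[of _ B]) blast
    qed
  next
    assume R: ?R
    show ?L unfolding coentourage_iff
    proof (intro conjI allI impI)
      fix E assume "entourage X E"
      then obtain r where r: "\<And>x y. (x, y) \<in> E \<Longrightarrow> mdist X x y \<le> r"
        unfolding entourage_iff by blast
      obtain B where B: "coarse_bounded X B"
        "\<And>x y. x \<in> mspace X - B \<Longrightarrow> y \<in> mspace X \<Longrightarrow> mdist X x y \<le> r \<Longrightarrow> \<exists>U\<in>\<U>. x \<in> U \<and> y \<in> U"
        using R by metis
      have "x \<in> B \<and> y \<in> B"
        if "(x, y) \<in> E" "x \<in> mspace X" "y \<in> mspace X" "(x, y) \<notin> (\<Union>U\<in>\<U>. U \<times> U)" for x y
        using B(2)[of x y] B(2)[of y x] r[OF that(1)] that by (auto simp: mdist_commute)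
      then show "\<exists>B. coarse_bounded X B \<and>
          E \<inter> (mspace X \<times> mspace X - (\<Union>U\<in>\<U>. U \<times> U)) \<subseteq> B \<times> B"
        using B(1) by (intro exI[of _ B]) auto
    qed blast
  qed
  then show ?thesis by (simp add: coarse_cover_def)
qed

lemma coarse_map_iff:
  "coarse_map X Y f \<longleftrightarrow>
     f \<in> mspace X \<rightarrow> mspace Y \<and>
     (\<forall>R. \<exists>S. \<forall>x\<in>mspace X. \<forall>y\<in>mspace X. mdist X x y \<le> R \<longrightarrow> mdist Y (f x) (f y) \<le> S) \<and>
     (\<forall>B. coarse_bounded Y B \<longrightarrow> coarse_bounded X (f -` B \<inter> mspace X))"
proof (cases "f \<in> mspace X \<rightarrow> mspace Y")
  case True
  have "(\<forall>E. entourage X E \<longrightarrow> entourage Y (map_prod f f ` E)) \<longleftrightarrow>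
    (\<forall>R. \<exists>S. \<forall>x\<in>mspace X. \<forall>y\<in>mspace X. mdist X x y \<le> R \<longrightarrow> mdist Y (f x) (f y) \<le> S)"
    (is "?L \<longleftrightarrow> ?R")
  proof
    assume L: ?L
    show ?R
    proof
      fix R
      let ?E = "{(x, y). x \<in> mspace X \<and> y \<in> mspace X \<and> mdist X x y \<le> R}"
      have "entourage X ?E" unfolding entourage_iff by auto
      then have "entourage Y (map_prod f f ` ?E)" using L by blast
      then show "\<exists>S. \<forall>x\<in>mspace X. \<forall>y\<in>mspace X. mdist X x y \<le> R \<longrightarrow> mdist Y (f x) (f y) \<le> S"
        unfolding entourage_iff by (elim conjE exE, intro exI ballI impI) auto
    qed
  next
    assume R: ?R
    show ?L
    proof (intro allI impI)
      fix E assume E: "entourage X E"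
      then obtain r where r: "\<And>x y. (x, y) \<in> E \<Longrightarrow> mdist X x y \<le> r"
        unfolding entourage_iff by blast
      obtain s where "\<And>x y. x \<in> mspace X \<Longrightarrow> y \<in> mspace X \<Longrightarrow> mdist X x y \<le> r \<Longrightarrow> mdist Y (f x) (f y) \<le> s"
        using R by metis
      then have "\<forall>(x, y)\<in>map_prod f f ` E. mdist Y x y \<le> s"
        using E r unfolding entourage_def by fastforce
      moreover have "map_prod f f ` E \<subseteq> mspace Y \<times> mspace Y"
        using True E unfolding entourage_def by fastforce
      ultimately show "entourage Y (map_prod f f ` E)" unfolding entourage_iff by blast
    qed
  qed
  with True show ?thesis by (simp add: coarse_map_def)
qed (simp add: coarse_map_def)

section \<open>Coarse containment and coarse stars\<close>

text \<open>
  This is \<open>S \<subseteq> E[T]\<close> for some entourage \<open>E\<close>. Both the equivalence of rays and the entourages of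
  the space of ends are expressed by it.
\<close>

definition coarsely_in :: "'a metric \<Rightarrow> 'a set \<Rightarrow> 'a set \<Rightarrow> bool" where
  "coarsely_in X S T \<longleftrightarrow> (\<exists>R. \<forall>s\<in>S. \<exists>t\<in>T. mdist X s t \<le> R)"

lemma coarsely_in_mono: "coarsely_in X S T \<Longrightarrow> T \<subseteq> T' \<Longrightarrow> coarsely_in X S T'"
  unfolding coarsely_in_def by (meson subsetD)

lemma coarsely_in_trans:
  assumes "coarsely_in X S T" "coarsely_in X T W"
    and "S \<subseteq> mspace X" "T \<subseteq> mspace X" "W \<subseteq> mspace X"
  shows "coarsely_in X S W"
proof -
  obtain R R' where R: "\<forall>s\<in>S. \<exists>t\<in>T. mdist X s t \<le> R" "\<forall>t\<in>T. \<exists>w\<in>W. mdist X t w \<le> R'"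
    using assms(1,2) unfolding coarsely_in_def by blast
  have "\<exists>w\<in>W. mdist X s w \<le> R + R'" if s: "s \<in> S" for s
  proof -
    obtain t w where tw: "t \<in> T" "mdist X s t \<le> R" "w \<in> W" "mdist X t w \<le> R'"
      using R s by blast
    have "mdist X s w \<le> mdist X s t + mdist X t w"
      by (rule mdist_triangle) (use assms(3-5) s tw in blast)+
    with tw show ?thesis by force
  qed
  then show ?thesis unfolding coarsely_in_def by blast
qed

text \<open>
  A bounded part of \<open>S\<close> does no harm: since \<open>S\<close> is unbounded, \<open>S - B\<close> has a point, so \<open>T\<close> has a
  point, and the bounded set \<open>B\<close> is at finite distance from that point.
\<close>

lemma coarsely_in_diff_bounded:
  assumes "coarsely_in X (S - B) T" "coarse_bounded X B"
    and "S \<subseteq> mspace X" "T \<subseteq> mspace X" "\<not> coarse_bounded X S"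
  shows "coarsely_in X S T"
proof -
  obtain R where R: "\<forall>s\<in>S - B. \<exists>t\<in>T. mdist X s t \<le> R"
    using assms(1) unfolding coarsely_in_def by blast
  obtain s where "s \<in> S - B" using assms(2,5) coarse_bounded_subset by blast
  with R obtain t where t: "t \<in> T" by blast
  obtain R' where R': "\<forall>b\<in>B. mdist X t b \<le> R'"
    using assms(2,4) t coarse_bounded_iff by (metis subsetD)
  have "\<exists>t\<in>T. mdist X s t \<le> max R R'" if "s \<in> S" for s
  proof (cases "s \<in> B")
    case True
    with R' t show ?thesis by (metis max.coboundedI2 mdist_commute)
  next
    case False
    with R that show ?thesis by (meson DiffI max.coboundedI1)
  qed
  then show ?thesis unfolding coarsely_in_def by blast
qed

lemma close_sets_commute:
  assumes "A \<subseteq> mspace X" "B \<subseteq> mspace X"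
  shows "close_sets X A B \<longleftrightarrow> close_sets X B A"
proof -
  have "close_sets X B A" if A: "A \<subseteq> mspace X" and B: "B \<subseteq> mspace X" and AB: "close_sets X A B" for A B
  proof -
    obtain R where R: "\<not> coarse_bounded X {a \<in> A. \<exists>b\<in>B. mdist X a b \<le> R}"
      using AB close_sets_iff[OF A B] by blast
    have "\<not> coarse_bounded X {b \<in> B. \<exists>a\<in>A. mdist X b a \<le> R}"
    proof
      assume bdd: "coarse_bounded X {b \<in> B. \<exists>a\<in>A. mdist X b a \<le> R}"
      have "coarse_bounded X {a \<in> A. \<exists>b\<in>B. mdist X a b \<le> R}"
      proof (rule coarse_bounded_neighbourhood[OF bdd, of _ R])
        have "mdist X b a \<le> R \<longleftrightarrow> mdist X a b \<le> R" for a b by (simp add: mdist_commute)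
        then show "\<forall>a\<in>{a \<in> A. \<exists>b\<in>B. mdist X a b \<le> R}.
            \<exists>b\<in>{b \<in> B. \<exists>a\<in>A. mdist X b a \<le> R}. mdist X a b \<le> R"
          by blast
      qed (use A in auto)
      with R show False by blast
    qed
    then show ?thesis using close_sets_iff[OF B A] by blast
  qed
  with assms show ?thesis by blast
qed

lemma close_sets_coarsely_in:
  assumes "close_sets X S U" "coarsely_in X S T"
    and S: "S \<subseteq> mspace X" and T: "T \<subseteq> mspace X" and U: "U \<subseteq> mspace X"
  shows "close_sets X T U"
proof -
  obtain R where R: "\<not> coarse_bounded X {a \<in> S. \<exists>u\<in>U. mdist X a u \<le> R}"
    using assms(1) close_sets_iff[OF S U] by blast
  obtain R' where R': "\<forall>s\<in>S. \<exists>t\<in>T. mdist X s t \<le> R'"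
    using assms(2) unfolding coarsely_in_def by blast
  let ?B = "{t \<in> T. \<exists>u\<in>U. mdist X t u \<le> R' + R}"
  have "\<exists>t\<in>?B. mdist X a t \<le> R'" if a: "a \<in> S" "\<exists>u\<in>U. mdist X a u \<le> R" for a
  proof -
    obtain u t where ut: "u \<in> U" "mdist X a u \<le> R" "t \<in> T" "mdist X a t \<le> R'"
      using a R' by blast
    moreover have "mdist X t u \<le> mdist X t a + mdist X a u"
      by (rule mdist_triangle) (use a ut S T U in auto)
    ultimately show ?thesis by (force simp: mdist_commute)
  qed
  then have "\<not> coarse_bounded X ?B"
    using R S coarse_bounded_neighbourhood[of X ?B "{a \<in> S. \<exists>u\<in>U. mdist X a u \<le> R}" R'] by blast
  then show ?thesis using close_sets_iff[OF T U] by blast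
qed

lemma coarsely_in_subset:
  assumes "S \<subseteq> T" "S \<subseteq> mspace X"
  shows "coarsely_in X S T"
  unfolding coarsely_in_def using assms
  by (intro exI[of _ 0] ballI) (metis mdist_zero order_refl subsetD)

lemma close_sets_mono:
  assumes "close_sets X A B" "B \<subseteq> B'" "A \<subseteq> mspace X" "B' \<subseteq> mspace X"
  shows "close_sets X A B'"
proof -
  have B: "B \<subseteq> mspace X" using assms by blast
  then have "close_sets X B A" using assms close_sets_commute by blast
  then have "close_sets X B' A"
    using close_sets_coarsely_in coarsely_in_subset assms B by metis
  then show ?thesis using assms close_sets_commute by blast
qed

text \<open>
  A pigeonhole principle: an unbounded set that is a finite union has an unbounded member.
\<close>

lemma close_sets_Union:
  assumes "close_sets X A (\<Union>\<F>)" "finite \<F>" "A \<subseteq> mspace X" "\<Union>\<F> \<subseteq> mspace X"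
  shows "\<exists>B\<in>\<F>. close_sets X A B"
proof (rule ccontr)
  assume not: "\<not> ?thesis"
  obtain R where R: "\<not> coarse_bounded X {a \<in> A. \<exists>b\<in>\<Union>\<F>. mdist X a b \<le> R}"
    using assms(1) close_sets_iff[OF assms(3,4)] by blast
  have "coarse_bounded X {a \<in> A. \<exists>b\<in>B. mdist X a b \<le> R}" if B: "B \<in> \<F>" for B
  proof -
    have "B \<subseteq> mspace X" "\<not> close_sets X A B" using B not assms(4) by auto
    with assms(3) show ?thesis by (simp add: close_sets_iff)
  qed
  then have "coarse_bounded X (\<Union>B\<in>\<F>. {a \<in> A. \<exists>b\<in>B. mdist X a b \<le> R})"
    using assms(2) by (intro coarse_bounded_UN) auto
  with R show False by (elim notE coarse_bounded_subset) blast
qed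

lemma coarse_star_subset:
  "coarse_cover X \<U> \<Longrightarrow> coarse_star X S \<U> \<subseteq> mspace X"
  unfolding coarse_star_def coarse_cover_def by blast

lemma coarse_star_mono:
  assumes "coarsely_in X S T" "S \<subseteq> mspace X" "T \<subseteq> mspace X" "coarse_cover X \<U>"
  shows "coarse_star X S \<U> \<subseteq> coarse_star X T \<U>"
proof -
  have "close_sets X T U" if "U \<in> \<U>" "close_sets X S U" for U
    using close_sets_coarsely_in[OF that(2) assms(1-3)] assms(4) that(1)
    unfolding coarse_cover_def by blast
  then show ?thesis unfolding coarse_star_def by blast
qed

text \<open>
  This gives reflexivity of the entourages of ends. A member of \<open>\<U>\<close> that is not close to \<open>S\<close> meets
  \<open>S\<close> in a bounded set only, and \<open>\<U>\<close> covers all but a bounded set, so all but a bounded part of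
  \<open>S\<close> lies in its star.
\<close>

lemma coarsely_in_coarse_star:
  assumes \<U>: "coarse_cover X \<U>" and S: "S \<subseteq> mspace X" "\<not> coarse_bounded X S"
  shows "coarsely_in X S (coarse_star X S \<U>)"
proof -
  obtain B where B: "coarse_bounded X B"
    and cov: "\<And>x y. x \<in> mspace X - B \<Longrightarrow> y \<in> mspace X \<Longrightarrow> mdist X x y \<le> 0 \<Longrightarrow> \<exists>U\<in>\<U>. x \<in> U \<and> y \<in> U"
    using \<U> unfolding coarse_cover_iff by meson
  let ?N = "{U \<in> \<U>. \<not> close_sets X S U}"
  have fin: "finite \<U>" and sub: "\<And>U. U \<in> \<U> \<Longrightarrow> U \<subseteq> mspace X"
    using \<U> by (auto simp: coarse_cover_def)
  have "coarse_bounded X (S \<inter> U)" if U: "U \<in> ?N" for U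
  proof -
    have "coarse_bounded X {a \<in> S. \<exists>u\<in>U. mdist X a u \<le> 0}"
      using U close_sets_iff[OF S(1) sub, of U] by blast
    then show ?thesis
      by (rule coarse_bounded_subset) (use S in \<open>auto intro!: bexI\<close>)
  qed
  then have "coarse_bounded X (\<Union>U\<in>?N. S \<inter> U)"
    using fin by (intro coarse_bounded_UN) auto
  then have bdd: "coarse_bounded X (B \<union> (\<Union>U\<in>?N. S \<inter> U))"
    using B coarse_bounded_Un by blast
  have "x \<in> coarse_star X S \<U>" if x: "x \<in> S - (B \<union> (\<Union>U\<in>?N. S \<inter> U))" for x
  proof -
    have "x \<in> mspace X" using x S by blast
    then obtain U where "U \<in> \<U>" "x \<in> U" using cov[of x x] x by auto
    with x show ?thesis unfolding coarse_star_def by blast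
  qed
  then have "coarsely_in X (S - (B \<union> (\<Union>U\<in>?N. S \<inter> U))) (coarse_star X S \<U>)"
    using S by (intro coarsely_in_subset) auto
  then show ?thesis
    using coarsely_in_diff_bounded bdd S coarse_star_subset[OF \<U>] by blast
qed

section \<open>Refinement of coarse covers\<close>

text \<open>
  The type \<open>\<tau> x\<close> of a point is the set of members of \<open>\<U>\<close> that contain it; there are only finitely
  many types. Say that \<open>F x r\<close> holds if any two points of the \<open>r\<close>-ball around \<open>x\<close> lie in a common
  member, that is, the types occurring in that ball pairwise intersect. Far out this holds for
  arbitrarily large \<open>r\<close>. The refinement consists of the sets \<open>V S\<close>, for sets \<open>S\<close> of types: a point
  \<open>x\<close> belongs to \<open>V S\<close> if its own type is in \<open>S\<close> and all types in \<open>S\<close> occur within \<open>r/2\<close> of \<open>x\<close>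
  for some \<open>r\<close> with \<open>F x r\<close>.

  If \<open>V S\<close> and \<open>V T\<close> are close, they have \<open>R\<close>-close points \<open>a\<close> and \<open>b\<close> so far out that \<open>R\<close>
  is at most half of the radii involved. The ball around \<open>a\<close> or \<open>b\<close> with the larger radius then
  sees all types in \<open>S \<union> T\<close>, so these types pairwise intersect. This is the assertion, as points
  of \<open>V S\<close> and \<open>V T\<close> have types in \<open>S\<close> and \<open>T\<close>.
\<close>

lemma coarse_cover_refinement:
  assumes \<U>: "coarse_cover X \<U>"
  shows "\<exists>\<V>. coarse_cover X \<V> \<and>
           (\<forall>V\<in>\<V>. \<forall>W\<in>\<V>. close_sets X V W \<longrightarrow> V \<times> W \<subseteq> (\<Union>U\<in>\<U>. U \<times> U))"
proof -
  define \<tau> where "\<tau> x = {U \<in> \<U>. x \<in> U}" for x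
  define F where "F x r \<longleftrightarrow> (\<forall>y\<in>mspace X. \<forall>z\<in>mspace X.
      mdist X x y \<le> r \<longrightarrow> mdist X x z \<le> r \<longrightarrow> (\<exists>U\<in>\<U>. y \<in> U \<and> z \<in> U))" for x r
  define V where "V S = {x \<in> mspace X. \<tau> x \<in> S \<and>
      (\<exists>r. F x r \<and> (\<forall>T\<in>S. \<exists>y\<in>mspace X. \<tau> y = T \<and> 2 * mdist X x y \<le> r))}" for S
  let ?\<V> = "V ` Pow (Pow \<U>)"
  have fin: "finite \<U>" using \<U> by (simp add: coarse_cover_def)
  have far: "\<exists>B. coarse_bounded X B \<and> (\<forall>x\<in>mspace X - B. F x r)" for r
  proof -
    obtain B where B: "coarse_bounded X B"
      and cov: "\<And>x y. x \<in> mspace X - B \<Longrightarrow> y \<in> mspace X \<Longrightarrow> mdist X x y \<le> 2 * r \<Longrightarrow> \<exists>U\<in>\<U>. x \<in> U \<and> y \<in> U"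
      using \<U> unfolding coarse_cover_iff by meson
    let ?B = "{x \<in> mspace X. \<exists>b\<in>B. mdist X x b \<le> r}"
    have "coarse_bounded X ?B"
      by (rule coarse_bounded_neighbourhood[OF B, of _ r]) auto
    moreover have "F x r" if x: "x \<in> mspace X - ?B" for x
      unfolding F_def
    proof (intro ballI impI)
      fix y z assume yz: "y \<in> mspace X" "z \<in> mspace X" "mdist X x y \<le> r" "mdist X x z \<le> r"
      have "mdist X y z \<le> mdist X y x + mdist X x z" by (rule mdist_triangle) (use x yz in auto)
      moreover have "y \<notin> B" using x yz by auto
      ultimately show "\<exists>U\<in>\<U>. y \<in> U \<and> z \<in> U"
        using cov[of y z] yz by (simp add: mdist_commute[of X y x])
    qed
    ultimately show ?thesis by blast
  qed
  have F_mono: "F x r'" if "F x r" "r' \<le> r" for x r r'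
    using that unfolding F_def by (meson order_trans)
  have F_move: "F y (r - mdist X x y)" if "F x r" "x \<in> mspace X" "y \<in> mspace X" for x y r
    unfolding F_def
  proof (intro ballI impI)
    fix z w assume zw: "z \<in> mspace X" "w \<in> mspace X"
      "mdist X y z \<le> r - mdist X x y" "mdist X y w \<le> r - mdist X x y"
    have "mdist X x z \<le> r" "mdist X x w \<le> r"
      using zw mdist_triangle[OF that(2,3) zw(1)] mdist_triangle[OF that(2,3) zw(2)] by auto
    then show "\<exists>U\<in>\<U>. z \<in> U \<and> w \<in> U" using that(1) zw unfolding F_def by blast
  qed
  have cover: "coarse_cover X ?\<V>"
    unfolding coarse_cover_iff
  proof (intro conjI allI)
    show "finite ?\<V>" using fin by simp
    show "\<forall>U\<in>?\<V>. U \<subseteq> mspace X" by (auto simp: V_def)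
    fix R :: real
    obtain B where B: "coarse_bounded X B" "\<forall>x\<in>mspace X - B. F x (3 * max R 0)"
      using far by blast
    have "\<exists>U\<in>?\<V>. x \<in> U \<and> y \<in> U" if xy: "x \<in> mspace X - B" "y \<in> mspace X" "mdist X x y \<le> R" for x y
    proof -
      have F3: "F x (3 * max R 0)" using B xy by blast
      then have Fx: "F x (2 * max R 0)" by (rule F_mono) simp
      have Fy: "F y (2 * max R 0)"
        using F_move[OF F3, of y] xy by (auto elim: F_mono)
      \<comment> \<open>Two points that are \<open>R\<close>-close share the member indexed by their two types.\<close>
      have "mdist X y x \<le> max R 0" using xy(3) by (simp add: mdist_commute)
      moreover have "mdist X x x \<le> 0" "mdist X y y \<le> 0" using xy by auto
      ultimately have "x \<in> V {\<tau> x, \<tau> y} \<and> y \<in> V {\<tau> x, \<tau> y}"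
        using Fx Fy xy unfolding V_def by fastforce
      moreover have "{\<tau> x, \<tau> y} \<in> Pow (Pow \<U>)" by (auto simp: \<tau>_def)
      ultimately show ?thesis by blast
    qed
    then show "\<exists>B. coarse_bounded X B \<and>
        (\<forall>x\<in>mspace X - B. \<forall>y\<in>mspace X. mdist X x y \<le> R \<longrightarrow> (\<exists>U\<in>?\<V>. x \<in> U \<and> y \<in> U))"
      using B(1) by blast
  qed
  have common: "\<exists>U\<in>\<U>. x \<in> U \<and> y \<in> U"
    if close: "close_sets X (V S) (V T)" and x: "x \<in> V S" and y: "y \<in> V T" for S T x y
  proof -
    have sub: "V S \<subseteq> mspace X" "V T \<subseteq> mspace X" by (auto simp: V_def)
    obtain R0 where R0: "\<not> coarse_bounded X {a \<in> V S. \<exists>b\<in>V T. mdist X a b \<le> R0}"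
      using close close_sets_iff[OF sub] by blast
    define R where "R = max R0 0"
    obtain B where B: "coarse_bounded X B" "\<forall>x\<in>mspace X - B. F x (3 * R)"
      using far by blast
    have "\<not> {a \<in> V S. \<exists>b\<in>V T. mdist X a b \<le> R0} \<subseteq> B"
      using R0 coarse_bounded_subset[OF B(1)] by blast
    then obtain a b where a: "a \<in> V S" "a \<notin> B" and b: "b \<in> V T" and abR0: "mdist X a b \<le> R0"
      by blast
    have abR: "mdist X a b \<le> R" and "R \<ge> 0" using abR0 by (auto simp: R_def)
    have aM: "a \<in> mspace X" and bM: "b \<in> mspace X" using a b sub by auto
    have F3: "F a (3 * R)" using B a aM by blast
    have Fb: "F b (2 * R)"
      using F_move[OF F3 aM bM] abR by (auto elim: F_mono)
    have Fa: "F a (2 * R)" using F3 by (rule F_mono) (use \<open>R \<ge> 0\<close> in simp)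
    obtain r1 u where r1: "F a r1" "u \<in> mspace X" "\<tau> u = \<tau> x" "2 * mdist X a u \<le> r1"
      using a x unfolding V_def by blast
    obtain r2 v where r2: "F b r2" "v \<in> mspace X" "\<tau> v = \<tau> y" "2 * mdist X b v \<le> r2"
      using b y unfolding V_def by blast
    \<comment> \<open>The radii witnessing membership may be small; far out they can be enlarged to \<open>2 * R\<close>.\<close>
    define s1 s2 where "s1 = max r1 (2 * R)" and "s2 = max r2 (2 * R)"
    have s: "F a s1" "F b s2" "2 * mdist X a u \<le> s1" "2 * mdist X b v \<le> s2" "2 * R \<le> s1" "2 * R \<le> s2"
      using r1 r2 Fa Fb by (auto simp: s1_def s2_def max_def)
    \<comment> \<open>The points \<open>u\<close> and \<open>v\<close> realise the types of \<open>x\<close> and \<open>y\<close> near \<open>a\<close> and \<open>b\<close>.\<close>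
    have "\<exists>U\<in>\<U>. u \<in> U \<and> v \<in> U"
    proof (cases "s2 \<le> s1")
      case True
      have "mdist X a v \<le> mdist X a b + mdist X b v" using aM bM r2(2) by (rule mdist_triangle)
      then have "mdist X a v \<le> s1" using True s abR by linarith
      moreover have "mdist X a u \<le> s1" using s \<open>R \<ge> 0\<close> by linarith
      ultimately show ?thesis using s(1) r1(2) r2(2) unfolding F_def by blast
    next
      case False
      have "mdist X b u \<le> mdist X b a + mdist X a u" using bM aM r1(2) by (rule mdist_triangle)
      then have "mdist X b u \<le> s2" using False s abR by (simp add: mdist_commute)
      moreover have "mdist X b v \<le> s2" using s \<open>R \<ge> 0\<close> by linarith
      ultimately show ?thesis using s(2) r1(2) r2(2) unfolding F_def by blast
    qed
    then show ?thesis using r1(3) r2(3) unfolding \<tau>_def by blast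
  qed
  have "V S \<times> V T \<subseteq> (\<Union>U\<in>\<U>. U \<times> U)" if "close_sets X (V S) (V T)" for S T
    using common[OF that] by fastforce
  then have "\<forall>V\<in>?\<V>. \<forall>W\<in>?\<V>. close_sets X V W \<longrightarrow> V \<times> W \<subseteq> (\<Union>U\<in>\<U>. U \<times> U)"
    by simp
  with cover show ?thesis by blast
qed

text \<open>
  Let \<open>z \<in> V\<close> with \<open>V\<close> close to \<open>T\<close>. As \<open>T\<close> is coarsely in the \<open>\<V>\<close>-star of \<open>S\<close>, some \<open>W \<in> \<V>\<close>
  is close to both \<open>V\<close> and \<open>S\<close>. Every point of \<open>W\<close> shares a member of \<open>\<U>\<close> with the fixed point
  \<open>z\<close>, so by the pigeonhole principle one member containing \<open>z\<close> is close to \<open>S\<close>.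
\<close>

lemma coarse_star_star_subset:
  assumes \<U>: "coarse_cover X \<U>" and \<V>: "coarse_cover X \<V>"
    and ref: "\<forall>V\<in>\<V>. \<forall>W\<in>\<V>. close_sets X V W \<longrightarrow> V \<times> W \<subseteq> (\<Union>U\<in>\<U>. U \<times> U)"
    and T: "coarsely_in X T (coarse_star X S \<V>)" and S: "S \<subseteq> mspace X" and TM: "T \<subseteq> mspace X"
  shows "coarse_star X T \<V> \<subseteq> coarse_star X S \<U>"
proof
  fix z assume "z \<in> coarse_star X T \<V>"
  then obtain V where V: "V \<in> \<V>" "close_sets X T V" "z \<in> V"
    unfolding coarse_star_def by blast
  have VM: "V \<subseteq> mspace X" using V \<V> by (auto simp: coarse_cover_def)
  have "close_sets X (coarse_star X S \<V>) V"
    using close_sets_coarsely_in[OF V(2) T TM coarse_star_subset[OF \<V>] VM] .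
  then have "close_sets X V (\<Union>{W \<in> \<V>. close_sets X S W})"
    using close_sets_commute[OF coarse_star_subset[OF \<V>] VM] by (simp add: coarse_star_def)
  then obtain W where W: "W \<in> \<V>" "close_sets X S W" "close_sets X V W"
    using close_sets_Union[of X V "{W \<in> \<V>. close_sets X S W}"] \<V> VM coarse_star_subset[OF \<V>, of S]
    by (auto simp: coarse_cover_def coarse_star_def)
  have sub: "W \<subseteq> \<Union>{U \<in> \<U>. z \<in> U}" using ref V W by blast
  have UM: "\<Union>{U \<in> \<U>. z \<in> U} \<subseteq> mspace X" using \<U> by (auto simp: coarse_cover_def)
  have "close_sets X S (\<Union>{U \<in> \<U>. z \<in> U})"
    using close_sets_mono[OF W(2) sub S UM] .
  then obtain U where "U \<in> \<U>" "z \<in> U" "close_sets X S U"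
    using close_sets_Union[OF _ _ S UM] \<U> by (auto simp: coarse_cover_def)
  then show "z \<in> coarse_star X S \<U>" unfolding coarse_star_def by blast
qed

section \<open>Rays and endpoints\<close>

lemma coarse_bounded_Z_plus: "coarse_bounded Z_plus B \<longleftrightarrow> finite B"
proof
  assume "coarse_bounded Z_plus B"
  then obtain R where R: "\<forall>n\<in>B. real n \<le> R"
    using coarse_bounded_iff[of 0 Z_plus B] by auto
  have "B \<subseteq> {..nat \<lceil>R\<rceil>}"
  proof
    fix n assume "n \<in> B"
    with R have "real n \<le> R" by blast
    then show "n \<in> {..nat \<lceil>R\<rceil>}" by (simp add: le_nat_iff) linarith
  qed
  then show "finite B" by (rule finite_subset) simp
qed (simp add: coarse_bounded_finite)

lemma coarse_ray_subset: "coarse_ray X \<phi> \<Longrightarrow> range \<phi> \<subseteq> mspace X"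
  unfolding coarse_ray_def coarse_map_def by auto

lemma coarse_ray_unbounded:
  assumes "coarse_ray X \<phi>"
  shows "\<not> coarse_bounded X (range \<phi>)"
proof
  assume "coarse_bounded X (range \<phi>)"
  then have "coarse_bounded Z_plus (\<phi> -` range \<phi> \<inter> mspace Z_plus)"
    using assms unfolding coarse_ray_def coarse_map_def by blast
  moreover have "\<phi> -` range \<phi> \<inter> mspace Z_plus = UNIV" by auto
  ultimately show False by (simp add: coarse_bounded_Z_plus)
qed

lemma finite_hausdorff_dist_iff:
  "finite_hausdorff_dist X A B \<longleftrightarrow> coarsely_in X A B \<and> coarsely_in X B A"
proof
  show "coarsely_in X A B \<and> coarsely_in X B A" if "finite_hausdorff_dist X A B"
    using that unfolding finite_hausdorff_dist_def coarsely_in_def by (metis mdist_commute)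
next
  assume "coarsely_in X A B \<and> coarsely_in X B A"
  then obtain R S where R: "\<forall>a\<in>A. \<exists>b\<in>B. mdist X a b \<le> R" and S: "\<forall>b\<in>B. \<exists>a\<in>A. mdist X b a \<le> S"
    unfolding coarsely_in_def by blast
  have "\<forall>a\<in>A. \<exists>b\<in>B. mdist X a b \<le> max R S" using R by (meson max.coboundedI1)
  moreover have "\<forall>b\<in>B. \<exists>a\<in>A. mdist X a b \<le> max R S"
    using S by (metis max.coboundedI2 mdist_commute)
  ultimately show "finite_hausdorff_dist X A B" unfolding finite_hausdorff_dist_def by blast
qed

definition ray_end :: "'a metric \<Rightarrow> (nat \<Rightarrow> 'a) \<Rightarrow> (nat \<Rightarrow> 'a) set" where
  "ray_end X \<phi> = end_rel X `` {\<phi>}"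

lemma mem_ray_end:
  "\<psi> \<in> ray_end X \<phi> \<longleftrightarrow> coarse_ray X \<phi> \<and> coarse_ray X \<psi> \<and>
     coarsely_in X (range \<phi>) (range \<psi>) \<and> coarsely_in X (range \<psi>) (range \<phi>)"
  by (auto simp: ray_end_def end_rel_def finite_hausdorff_dist_iff)

lemma equiv_end_rel: "equiv {\<phi>. coarse_ray X \<phi>} (end_rel X)"
proof (rule equivI)
  show "end_rel X \<subseteq> {\<phi>. coarse_ray X \<phi>} \<times> {\<phi>. coarse_ray X \<phi>}"
    by (auto simp: end_rel_def)
  show "refl_on {\<phi>. coarse_ray X \<phi>} (end_rel X)"
    by (auto simp: refl_on_def end_rel_def finite_hausdorff_dist_iff
        intro: coarsely_in_subset dest: coarse_ray_subset)
  show "sym (end_rel X)"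
    by (auto simp: sym_def end_rel_def finite_hausdorff_dist_iff)
  show "trans (end_rel X)"
    unfolding trans_def end_rel_def finite_hausdorff_dist_iff
    by (auto intro: coarsely_in_trans dest!: coarse_ray_subset)
qed

lemma ray_end_in_ends: "coarse_ray X \<phi> \<Longrightarrow> ray_end X \<phi> \<in> ends X"
  by (simp add: ends_def ray_end_def quotientI)

lemma endsE:
  assumes "p \<in> ends X"
  obtains \<phi> where "coarse_ray X \<phi>" "p = ray_end X \<phi>"
  using assms by (auto simp: ends_def ray_end_def elim: quotientE)

lemma ray_end_eq_iff:
  assumes "coarse_ray X \<phi>" "coarse_ray X \<psi>"
  shows "ray_end X \<phi> = ray_end X \<psi> \<longleftrightarrow>
    coarsely_in X (range \<phi>) (range \<psi>) \<and> coarsely_in X (range \<psi>) (range \<phi>)"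
  using eq_equiv_class_iff[OF equiv_end_rel, of \<phi> X \<psi>] assms
  by (auto simp: ray_end_def end_rel_def finite_hausdorff_dist_iff)

text \<open>
  Independence of representatives: coarse stars of coarsely equivalent sets agree, and coarse
  containment is transitive.
\<close>

lemma end_entourage_iff:
  assumes \<phi>: "coarse_ray X \<phi>" and \<psi>: "coarse_ray X \<psi>" and \<U>: "coarse_cover X \<U>"
  shows "(ray_end X \<phi>, ray_end X \<psi>) \<in> end_entourage X \<U> \<longleftrightarrow>
    coarsely_in X (range \<psi>) (coarse_star X (range \<phi>) \<U>) \<and>
    coarsely_in X (range \<phi>) (coarse_star X (range \<psi>) \<U>)"
proof
  assume L: "(ray_end X \<phi>, ray_end X \<psi>) \<in> end_entourage X \<U>"
  then obtain \<alpha> \<beta> E where \<alpha>: "\<alpha> \<in> ray_end X \<phi>" and \<beta>: "\<beta> \<in> ray_end X \<psi>" and E: "entourage X E"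
    and sub: "range \<beta> \<subseteq> E\<inverse> `` coarse_star X (range \<alpha>) \<U>" "range \<alpha> \<subseteq> E\<inverse> `` coarse_star X (range \<beta>) \<U>"
    unfolding end_entourage_def by blast
  obtain R where R: "\<And>x y. (x, y) \<in> E \<Longrightarrow> mdist X x y \<le> R"
    using E unfolding entourage_iff by blast
  have near: "coarsely_in X S T" if "S \<subseteq> E\<inverse> `` T" for S T
    unfolding coarsely_in_def using that R by (intro exI[of _ R]) blast
  have key: "coarsely_in X (range \<sigma>) (coarse_star X (range \<rho>) \<U>)"
    if "\<rho>' \<in> ray_end X \<rho>" "\<sigma>' \<in> ray_end X \<sigma>" "range \<sigma>' \<subseteq> E\<inverse> `` coarse_star X (range \<rho>') \<U>"
    for \<rho> \<rho>' \<sigma> \<sigma>'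
  proof -
    note sub = coarse_ray_subset coarse_star_subset[OF \<U>]
    have "coarsely_in X (range \<sigma>) (range \<sigma>')" "coarsely_in X (range \<rho>') (range \<rho>)"
      and rays: "coarse_ray X \<rho>" "coarse_ray X \<sigma>" "coarse_ray X \<rho>'" "coarse_ray X \<sigma>'"
      using that by (auto simp: mem_ray_end)
    moreover have "coarsely_in X (range \<sigma>') (coarse_star X (range \<rho>') \<U>)"
      using near that(3) .
    ultimately have "coarsely_in X (range \<sigma>) (coarse_star X (range \<rho>') \<U>)"
      using coarsely_in_trans sub by metis
    then show ?thesis
      using coarse_star_mono[OF \<open>coarsely_in X (range \<rho>') (range \<rho>)\<close> _ _ \<U>] rays sub coarsely_in_mono
      by metis
  qed
  show "coarsely_in X (range \<psi>) (coarse_star X (range \<phi>) \<U>) \<and>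
    coarsely_in X (range \<phi>) (coarse_star X (range \<psi>) \<U>)"
    using key[OF \<alpha> \<beta> sub(1)] key[OF \<beta> \<alpha> sub(2)] by blast
next
  assume R: "coarsely_in X (range \<psi>) (coarse_star X (range \<phi>) \<U>) \<and>
    coarsely_in X (range \<phi>) (coarse_star X (range \<psi>) \<U>)"
  then obtain r s where r: "\<forall>x\<in>range \<psi>. \<exists>y\<in>coarse_star X (range \<phi>) \<U>. mdist X x y \<le> r"
    and s: "\<forall>x\<in>range \<phi>. \<exists>y\<in>coarse_star X (range \<psi>) \<U>. mdist X x y \<le> s"
    unfolding coarsely_in_def by blast
  define E where "E = {(x, y). x \<in> mspace X \<and> y \<in> mspace X \<and> mdist X x y \<le> max r s}"
  have E: "entourage X E" unfolding entourage_iff E_def by auto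
  have near: "S \<subseteq> E\<inverse> `` T"
    if ST: "S \<subseteq> mspace X" "T \<subseteq> mspace X" "\<forall>x\<in>S. \<exists>y\<in>T. mdist X x y \<le> t" "t \<le> max r s" for S T t
  proof
    fix x assume x: "x \<in> S"
    then obtain y where "y \<in> T" "mdist X x y \<le> t" using ST(3) by blast
    then show "x \<in> E\<inverse> `` T" using x ST(1,2,4) unfolding E_def by fastforce
  qed
  have "range \<psi> \<subseteq> E\<inverse> `` coarse_star X (range \<phi>) \<U>"
    by (rule near[OF coarse_ray_subset[OF \<psi>] coarse_star_subset[OF \<U>] r]) simp
  moreover have "range \<phi> \<subseteq> E\<inverse> `` coarse_star X (range \<psi>) \<U>"
    by (rule near[OF coarse_ray_subset[OF \<phi>] coarse_star_subset[OF \<U>] s]) simp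
  moreover have "\<rho> \<in> ray_end X \<rho>" if "coarse_ray X \<rho>" for \<rho>
    using that coarse_ray_subset[OF that] by (simp add: mem_ray_end coarsely_in_subset)
  ultimately show "(ray_end X \<phi>, ray_end X \<psi>) \<in> end_entourage X \<U>"
    unfolding end_entourage_def using E \<phi> \<psi> ray_end_in_ends by blast
qed

lemma end_entourage_subset: "end_entourage X \<U> \<subseteq> ends X \<times> ends X"
  by (auto simp: end_entourage_def)

lemma end_entourage_commute: "(p, q) \<in> end_entourage X \<U> \<longleftrightarrow> (q, p) \<in> end_entourage X \<U>"
  unfolding end_entourage_def by blast

section \<open>The uniformity on the set of endpoints\<close>

lemma coarse_cover_whole: "coarse_cover X {mspace X}"
  unfolding coarse_cover_iff by (auto intro!: exI[of _ "{}"])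

lemma coarse_cover_inf:
  assumes "coarse_cover X \<U>" "coarse_cover X \<V>"
  shows "coarse_cover X ((\<lambda>(U, V). U \<inter> V) ` (\<U> \<times> \<V>))" (is "coarse_cover X ?\<W>")
  unfolding coarse_cover_iff
proof (intro conjI allI)
  show "finite ?\<W>" using assms by (auto simp: coarse_cover_def)
  show "\<forall>U\<in>?\<W>. U \<subseteq> mspace X" using assms by (fastforce simp: coarse_cover_def)
  fix R
  obtain B where B: "coarse_bounded X B"
    "\<And>x y. x \<in> mspace X - B \<Longrightarrow> y \<in> mspace X \<Longrightarrow> mdist X x y \<le> R \<Longrightarrow> \<exists>U\<in>\<U>. x \<in> U \<and> y \<in> U"
    using assms(1) unfolding coarse_cover_iff by meson
  obtain C where C: "coarse_bounded X C"
    "\<And>x y. x \<in> mspace X - C \<Longrightarrow> y \<in> mspace X \<Longrightarrow> mdist X x y \<le> R \<Longrightarrow> \<exists>U\<in>\<V>. x \<in> U \<and> y \<in> U"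
    using assms(2) unfolding coarse_cover_iff by meson
  have "\<exists>W\<in>?\<W>. x \<in> W \<and> y \<in> W" if xy: "x \<in> mspace X - (B \<union> C)" "y \<in> mspace X" "mdist X x y \<le> R" for x y
  proof -
    obtain U V where "U \<in> \<U>" "x \<in> U" "y \<in> U" "V \<in> \<V>" "x \<in> V" "y \<in> V"
      using B(2)[of x y] C(2)[of x y] xy by auto
    then show ?thesis by (intro bexI[of _ "U \<inter> V"]) auto
  qed
  then show "\<exists>B. coarse_bounded X B \<and>
      (\<forall>x\<in>mspace X - B. \<forall>y\<in>mspace X. mdist X x y \<le> R \<longrightarrow> (\<exists>W\<in>?\<W>. x \<in> W \<and> y \<in> W))"
    using coarse_bounded_Un[OF B(1) C(1)] by blast
qed

lemma end_entourage_mono: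
  assumes \<U>: "coarse_cover X \<U>" and \<W>: "coarse_cover X \<W>"
    and ref: "\<forall>W\<in>\<W>. \<exists>U\<in>\<U>. W \<subseteq> U"
  shows "end_entourage X \<W> \<subseteq> end_entourage X \<U>"
proof (rule subrelI)
  fix p q assume pq: "(p, q) \<in> end_entourage X \<W>"
  then obtain \<phi> \<psi> where \<phi>: "coarse_ray X \<phi>" "p = ray_end X \<phi>" and \<psi>: "coarse_ray X \<psi>" "q = ray_end X \<psi>"
    using end_entourage_subset by (metis endsE mem_Sigma_iff subsetD)
  have star: "coarse_star X S \<W> \<subseteq> coarse_star X S \<U>" if S: "S \<subseteq> mspace X" for S
  proof
    fix x assume "x \<in> coarse_star X S \<W>"
    then obtain W where W: "W \<in> \<W>" "close_sets X S W" "x \<in> W" unfolding coarse_star_def by blast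
    with ref obtain U where U: "U \<in> \<U>" "W \<subseteq> U" by blast
    have "U \<subseteq> mspace X" using \<U> U by (auto simp: coarse_cover_def)
    then have "close_sets X S U" using close_sets_mono[OF W(2) U(2) S] by blast
    with U W show "x \<in> coarse_star X S \<U>" unfolding coarse_star_def by blast
  qed
  show "(p, q) \<in> end_entourage X \<U>"
    using pq star[OF coarse_ray_subset[OF \<phi>(1)]] star[OF coarse_ray_subset[OF \<psi>(1)]]
    unfolding \<phi> \<psi> end_entourage_iff[OF \<phi>(1) \<psi>(1) \<U>] end_entourage_iff[OF \<phi>(1) \<psi>(1) \<W>]
    by (meson coarsely_in_mono)
qed

lemma end_entourage_refl:
  assumes "coarse_cover X \<U>" "p \<in> ends X"
  shows "(p, p) \<in> end_entourage X \<U>"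
proof -
  obtain \<phi> where \<phi>: "coarse_ray X \<phi>" "p = ray_end X \<phi>" using assms(2) by (rule endsE)
  then show ?thesis
    using end_entourage_iff[OF \<phi>(1) \<phi>(1) assms(1)]
      coarsely_in_coarse_star[OF assms(1) coarse_ray_subset coarse_ray_unbounded] by simp
qed

lemma end_entourage_compose:
  assumes \<U>: "coarse_cover X \<U>"
  shows "\<exists>\<V>. coarse_cover X \<V> \<and> end_entourage X \<V> O end_entourage X \<V> \<subseteq> end_entourage X \<U>"
proof -
  obtain \<V> where \<V>: "coarse_cover X \<V>"
    and ref: "\<forall>V\<in>\<V>. \<forall>W\<in>\<V>. close_sets X V W \<longrightarrow> V \<times> W \<subseteq> (\<Union>U\<in>\<U>. U \<times> U)"
    using coarse_cover_refinement[OF \<U>] by blast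
  have "(p, r) \<in> end_entourage X \<U>"
    if pq: "(p, q) \<in> end_entourage X \<V>" and qr: "(q, r) \<in> end_entourage X \<V>" for p q r
  proof -
    obtain \<phi> \<psi> \<theta> where \<phi>: "coarse_ray X \<phi>" "p = ray_end X \<phi>" and \<psi>: "coarse_ray X \<psi>" "q = ray_end X \<psi>"
      and \<theta>: "coarse_ray X \<theta>" "r = ray_end X \<theta>"
      using end_entourage_subset pq qr by (metis endsE mem_Sigma_iff subsetD)
    note sub = coarse_ray_subset[OF \<phi>(1)] coarse_ray_subset[OF \<psi>(1)] coarse_ray_subset[OF \<theta>(1)]
    have *: "coarsely_in X (range \<psi>) (coarse_star X (range \<phi>) \<V>)"
        "coarsely_in X (range \<phi>) (coarse_star X (range \<psi>) \<V>)"
      using pq unfolding \<phi> \<psi> end_entourage_iff[OF \<phi>(1) \<psi>(1) \<V>] by auto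
    have **: "coarsely_in X (range \<theta>) (coarse_star X (range \<psi>) \<V>)"
        "coarsely_in X (range \<psi>) (coarse_star X (range \<theta>) \<V>)"
      using qr unfolding \<psi> \<theta> end_entourage_iff[OF \<psi>(1) \<theta>(1) \<V>] by auto
    have "coarsely_in X (range \<theta>) (coarse_star X (range \<phi>) \<U>)"
      using **(1) coarse_star_star_subset[OF \<U> \<V> ref *(1) sub(1,2)] by (rule coarsely_in_mono)
    moreover have "coarsely_in X (range \<phi>) (coarse_star X (range \<theta>) \<U>)"
      using *(2) coarse_star_star_subset[OF \<U> \<V> ref **(2) sub(3,2)] by (rule coarsely_in_mono)
    ultimately show ?thesis
      unfolding \<phi> \<theta> end_entourage_iff[OF \<phi>(1) \<theta>(1) \<U>] by blast
  qed
  with \<V> show ?thesis by blast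
qed

lemma fst_ends_space [simp]: "fst (ends_space X) = ends X"
  by (simp add: ends_space_def)

lemma snd_ends_space:
  "D \<in> snd (ends_space X) \<longleftrightarrow>
     D \<subseteq> ends X \<times> ends X \<and> (\<exists>\<U>. coarse_cover X \<U> \<and> end_entourage X \<U> \<subseteq> D)"
  by (simp add: ends_space_def)

lemma uniform_structure_ends_space: "uniform_structure (ends_space X)"
  unfolding uniform_structure_def fst_ends_space
proof (intro conjI ballI allI impI)
  show "ends X \<times> ends X \<in> snd (ends_space X)"
    using coarse_cover_whole end_entourage_subset unfolding snd_ends_space by blast
next
  fix D assume "D \<in> snd (ends_space X)"
  then show "Id_on (ends X) \<subseteq> D" "D \<subseteq> ends X \<times> ends X"
    using end_entourage_refl unfolding snd_ends_space by blast+
next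
  fix D D' assume "D \<in> snd (ends_space X)" "D \<subseteq> D' \<and> D' \<subseteq> ends X \<times> ends X"
  then show "D' \<in> snd (ends_space X)"
    unfolding snd_ends_space by blast
next
  fix D D' assume "D \<in> snd (ends_space X)" "D' \<in> snd (ends_space X)"
  then obtain \<U> \<V> where \<U>: "coarse_cover X \<U>" "end_entourage X \<U> \<subseteq> D"
    and \<V>: "coarse_cover X \<V>" "end_entourage X \<V> \<subseteq> D'" and D: "D \<subseteq> ends X \<times> ends X"
    unfolding snd_ends_space by blast
  let ?\<W> = "(\<lambda>(U, V). U \<inter> V) ` (\<U> \<times> \<V>)"
  have \<W>: "coarse_cover X ?\<W>" using coarse_cover_inf \<U>(1) \<V>(1) .
  have "end_entourage X ?\<W> \<subseteq> end_entourage X \<U>"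
    by (rule end_entourage_mono[OF \<U>(1) \<W>]) auto
  moreover have "end_entourage X ?\<W> \<subseteq> end_entourage X \<V>"
    by (rule end_entourage_mono[OF \<V>(1) \<W>]) auto
  ultimately have "end_entourage X ?\<W> \<subseteq> D \<inter> D'" using \<U>(2) \<V>(2) by blast
  with \<W> D show "D \<inter> D' \<in> snd (ends_space X)"
    unfolding snd_ends_space by blast
next
  fix D assume D: "D \<in> snd (ends_space X)"
  then obtain \<U> where \<U>: "coarse_cover X \<U>" "end_entourage X \<U> \<subseteq> D"
    unfolding snd_ends_space by blast
  have "end_entourage X \<U> \<subseteq> D\<inverse>"
  proof (rule subrelI)
    fix p q assume "(p, q) \<in> end_entourage X \<U>"
    then have "(q, p) \<in> end_entourage X \<U>" by (simp add: end_entourage_commute)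
    with \<U>(2) show "(p, q) \<in> D\<inverse>" by blast
  qed
  with D \<U>(1) show "D\<inverse> \<in> snd (ends_space X)"
    unfolding snd_ends_space by blast
next
  fix D assume "D \<in> snd (ends_space X)"
  then obtain \<U> where \<U>: "coarse_cover X \<U>" "end_entourage X \<U> \<subseteq> D"
    unfolding snd_ends_space by blast
  obtain \<V> where "coarse_cover X \<V>" "end_entourage X \<V> O end_entourage X \<V> \<subseteq> end_entourage X \<U>"
    using end_entourage_compose[OF \<U>(1)] by blast
  then show "\<exists>D'\<in>snd (ends_space X). D' O D' \<subseteq> D"
    using \<U>(2) end_entourage_subset[of X \<V>]
    by (intro bexI[of _ "end_entourage X \<V>"]) (auto simp: snd_ends_space)
qed

section \<open>Functoriality\<close>

lemma coarse_map_compose: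
  assumes f: "coarse_map X Y f" and g: "coarse_map Y Z g"
  shows "coarse_map X Z (g \<circ> f)"
  unfolding coarse_map_iff
proof (intro conjI allI impI)
  show "g \<circ> f \<in> mspace X \<rightarrow> mspace Z"
    using assms by (auto simp: coarse_map_def)
  fix R
  obtain S where S: "\<And>x y. x \<in> mspace X \<Longrightarrow> y \<in> mspace X \<Longrightarrow> mdist X x y \<le> R \<Longrightarrow> mdist Y (f x) (f y) \<le> S"
    using f unfolding coarse_map_iff by metis
  obtain T where "\<And>x y. x \<in> mspace Y \<Longrightarrow> y \<in> mspace Y \<Longrightarrow> mdist Y x y \<le> S \<Longrightarrow> mdist Z (g x) (g y) \<le> T"
    using g unfolding coarse_map_iff by metis
  moreover have "f x \<in> mspace Y" if "x \<in> mspace X" for x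
    using f that by (auto simp: coarse_map_def)
  ultimately show "\<exists>T. \<forall>x\<in>mspace X. \<forall>y\<in>mspace X. mdist X x y \<le> R \<longrightarrow> mdist Z ((g \<circ> f) x) ((g \<circ> f) y) \<le> T"
    using S by (intro exI[of _ T]) simp
next
  fix B assume "coarse_bounded Z B"
  then have "coarse_bounded X (f -` (g -` B \<inter> mspace Y) \<inter> mspace X)"
    using f g unfolding coarse_map_def by blast
  then show "coarse_bounded X ((g \<circ> f) -` B \<inter> mspace X)"
    by (rule coarse_bounded_subset) (use f in \<open>auto simp: coarse_map_def\<close>)
qed

lemma coarse_ray_compose: "coarse_map X Y f \<Longrightarrow> coarse_ray X \<phi> \<Longrightarrow> coarse_ray Y (f \<circ> \<phi>)"
  unfolding coarse_ray_def by (rule coarse_map_compose)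

lemma coarse_map_id: "coarse_map X X id"
  unfolding coarse_map_iff
proof (intro conjI allI impI)
  fix B assume "coarse_bounded X B"
  then show "coarse_bounded X (id -` B \<inter> mspace X)" by (rule coarse_bounded_subset) auto
qed auto

lemma coarsely_in_image:
  assumes f: "coarse_map X Y f" and ST: "S \<subseteq> mspace X" "T \<subseteq> mspace X" "coarsely_in X S T"
  shows "coarsely_in Y (f ` S) (f ` T)"
proof -
  obtain R where R: "\<forall>s\<in>S. \<exists>t\<in>T. mdist X s t \<le> R" using ST unfolding coarsely_in_def by blast
  obtain R' where R': "\<And>x y. x \<in> mspace X \<Longrightarrow> y \<in> mspace X \<Longrightarrow> mdist X x y \<le> R \<Longrightarrow> mdist Y (f x) (f y) \<le> R'"
    using f unfolding coarse_map_iff by metis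
  have "\<exists>t\<in>T. mdist Y (f s) (f t) \<le> R'" if "s \<in> S" for s
    using R R' ST that by (meson subsetD)
  then show ?thesis unfolding coarsely_in_def by (intro exI[of _ R']) auto
qed

lemma close_sets_image:
  assumes f: "coarse_map X Y f" and ST: "S \<subseteq> mspace X" "T \<subseteq> mspace X" "close_sets X S T"
  shows "close_sets Y (f ` S) (f ` T)"
proof -
  obtain R where R: "\<not> coarse_bounded X {a \<in> S. \<exists>b\<in>T. mdist X a b \<le> R}"
    using ST(3) close_sets_iff[OF ST(1,2)] by blast
  obtain R' where R': "\<And>x y. x \<in> mspace X \<Longrightarrow> y \<in> mspace X \<Longrightarrow> mdist X x y \<le> R \<Longrightarrow> mdist Y (f x) (f y) \<le> R'"
    using f unfolding coarse_map_iff by metis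
  let ?B = "{a \<in> f ` S. \<exists>b\<in>f ` T. mdist Y a b \<le> R'}"
  have "\<not> coarse_bounded Y ?B"
  proof
    assume "coarse_bounded Y ?B"
    then have bdd: "coarse_bounded X (f -` ?B \<inter> mspace X)"
      using f unfolding coarse_map_def by blast
    have "{a \<in> S. \<exists>b\<in>T. mdist X a b \<le> R} \<subseteq> f -` ?B \<inter> mspace X"
      using R' ST by fastforce
    with R bdd show False using coarse_bounded_subset by blast
  qed
  moreover have "f ` S \<subseteq> mspace Y" "f ` T \<subseteq> mspace Y"
    using f ST by (auto simp: coarse_map_def)
  ultimately show ?thesis by (auto simp: close_sets_iff)
qed

lemma close_maps_iff:
  assumes "coarse_map X Y f" "coarse_map X Y g"
  shows "close_maps X Y f g \<longleftrightarrow> (\<exists>R. \<forall>x\<in>mspace X. mdist Y (f x) (g x) \<le> R)"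
proof -
  have "(\<lambda>x. (f x, g x)) ` mspace X \<subseteq> mspace Y \<times> mspace Y"
    using assms by (auto simp: coarse_map_def)
  then show ?thesis by (simp add: close_maps_def entourage_iff)
qed

text \<open>
  The relation whose classes are the morphisms of the coarse category.
\<close>

definition closeness :: "'a metric \<Rightarrow> 'b metric \<Rightarrow> (('a \<Rightarrow> 'b) \<times> ('a \<Rightarrow> 'b)) set" where
  "closeness X Y = {(f, g). coarse_map X Y f \<and> coarse_map X Y g \<and> close_maps X Y f g}"

definition coarse_class :: "'a metric \<Rightarrow> 'b metric \<Rightarrow> ('a \<Rightarrow> 'b) \<Rightarrow> ('a \<Rightarrow> 'b) set" where
  "coarse_class X Y f = closeness X Y `` {f}"

lemma mem_closeness:
  "(f, g) \<in> closeness X Y \<longleftrightarrow> coarse_map X Y f \<and> coarse_map X Y g \<and>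
    (\<exists>R. \<forall>x\<in>mspace X. mdist Y (f x) (g x) \<le> R)"
  using close_maps_iff[of X Y f g] unfolding closeness_def by blast

lemma equiv_closeness: "equiv {f. coarse_map X Y f} (closeness X Y)"
proof (rule equivI)
  show "closeness X Y \<subseteq> {f. coarse_map X Y f} \<times> {f. coarse_map X Y f}"
    by (auto simp: closeness_def)
  show "refl_on {f. coarse_map X Y f} (closeness X Y)"
    unfolding refl_on_def mem_closeness
    by (auto simp: coarse_map_def Pi_iff intro!: exI[of _ 0])
  show "sym (closeness X Y)"
    unfolding sym_def mem_closeness by (auto simp: mdist_commute)
  show "trans (closeness X Y)"
  proof (rule transI)
    fix f g h assume fg: "(f, g) \<in> closeness X Y" and gh: "(g, h) \<in> closeness X Y"
    then have *: "coarse_map X Y f" "coarse_map X Y g" "coarse_map X Y h"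
      by (auto simp: mem_closeness)
    obtain R S where R: "\<forall>x\<in>mspace X. mdist Y (f x) (g x) \<le> R"
      and S: "\<forall>x\<in>mspace X. mdist Y (g x) (h x) \<le> S"
      using fg gh by (auto simp: mem_closeness)
    have "mdist Y (f x) (h x) \<le> R + S" if x: "x \<in> mspace X" for x
    proof -
      have "mdist Y (f x) (h x) \<le> mdist Y (f x) (g x) + mdist Y (g x) (h x)"
        by (rule mdist_triangle) (use * x in \<open>auto simp: coarse_map_def\<close>)
      also have "\<dots> \<le> R + S" using R S x by (intro add_mono) auto
      finally show ?thesis .
    qed
    then show "(f, h) \<in> closeness X Y"
      using * unfolding mem_closeness by blast
  qed
qed

lemma coarse_class_in_hom: "coarse_map X Y f \<Longrightarrow> coarse_class X Y f \<in> mCoarse_hom X Y"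
  unfolding coarse_class_def mCoarse_hom_def closeness_def[symmetric] by (simp add: quotientI)

lemma mCoarse_homE:
  assumes "F \<in> mCoarse_hom X Y"
  obtains f where "coarse_map X Y f" "F = coarse_class X Y f"
  using assms unfolding mCoarse_hom_def closeness_def[symmetric]
  by (auto simp: coarse_class_def elim!: quotientE)

lemma coarse_class_eq_iff:
  assumes "coarse_map X Y f" "coarse_map X Y g"
  shows "coarse_class X Y f = coarse_class X Y g \<longleftrightarrow> (f, g) \<in> closeness X Y"
  using eq_equiv_class_iff[OF equiv_closeness, of f X Y g] assms by (simp add: coarse_class_def)

lemma closeness_compose:
  assumes f: "(f, f') \<in> closeness X Y" and g: "(g, g') \<in> closeness Y Z"
  shows "(g \<circ> f, g' \<circ> f') \<in> closeness X Z"
proof -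
  have fs: "coarse_map X Y f" "coarse_map X Y f'" "coarse_map Y Z g" "coarse_map Y Z g'"
    using assms by (auto simp: closeness_def)
  obtain R S where R: "\<forall>x\<in>mspace X. mdist Y (f x) (f' x) \<le> R" and S: "\<forall>y\<in>mspace Y. mdist Z (g y) (g' y) \<le> S"
    using assms by (auto simp: mem_closeness)
  obtain R' where R': "\<And>x y. x \<in> mspace Y \<Longrightarrow> y \<in> mspace Y \<Longrightarrow> mdist Y x y \<le> R \<Longrightarrow> mdist Z (g x) (g y) \<le> R'"
    using fs(3) unfolding coarse_map_iff by metis
  have "mdist Z (g (f x)) (g' (f' x)) \<le> R' + S" if x: "x \<in> mspace X" for x
  proof -
    have in_Y: "f x \<in> mspace Y" "f' x \<in> mspace Y" using fs x by (auto simp: coarse_map_def)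
    have "mdist Z (g (f x)) (g' (f' x)) \<le> mdist Z (g (f x)) (g (f' x)) + mdist Z (g (f' x)) (g' (f' x))"
      by (rule mdist_triangle) (use fs in_Y in \<open>auto simp: coarse_map_def\<close>)
    also have "\<dots> \<le> R' + S" using R R' S x in_Y by (intro add_mono) auto
    finally show ?thesis .
  qed
  then have "\<forall>x\<in>mspace X. mdist Z ((g \<circ> f) x) ((g' \<circ> f') x) \<le> R' + S" by simp
  then show ?thesis
    unfolding mem_closeness using fs coarse_map_compose by blast
qed

lemma closeness_refl: "coarse_map X Y f \<Longrightarrow> (f, f) \<in> closeness X Y"
  using equiv_closeness[of X Y] by (auto simp: equiv_def refl_on_def)

lemma mCoarse_comp_class:
  assumes "coarse_map X Y f" "coarse_map Y Z g"
  shows "mCoarse_comp X Z (coarse_class Y Z g) (coarse_class X Y f) = coarse_class X Z (g \<circ> f)"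
proof -
  have "mCoarse_comp X Z (coarse_class Y Z g) (coarse_class X Y f) =
    closeness X Z `` {g' \<circ> f' |g' f'. (g, g') \<in> closeness Y Z \<and> (f, f') \<in> closeness X Y}"
    by (simp add: mCoarse_comp_def closeness_def coarse_class_def)
  also have "\<dots> = closeness X Z `` {g \<circ> f}" (is "closeness X Z `` ?S = _")
  proof -
    have tr: "trans (closeness X Z)" using equiv_closeness by (rule equivE)
    have "g \<circ> f \<in> ?S" using closeness_refl[OF assms(1)] closeness_refl[OF assms(2)] by blast
    moreover have "(g \<circ> f, h) \<in> closeness X Z" if "h \<in> ?S" for h
      using that closeness_compose by blast
    ultimately show ?thesis using transD[OF tr] by blast
  qed
  finally show ?thesis by (simp add: coarse_class_def)
qed

lemma ray_end_compose_eq: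
  assumes fg: "(f, g) \<in> closeness X Y" and \<phi>: "\<psi> \<in> ray_end X \<phi>"
  shows "ray_end Y (f \<circ> \<phi>) = ray_end Y (g \<circ> \<psi>)"
proof -
  have fs: "coarse_map X Y f" "coarse_map X Y g" and rays: "coarse_ray X \<phi>" "coarse_ray X \<psi>"
    and co: "coarsely_in X (range \<phi>) (range \<psi>)" "coarsely_in X (range \<psi>) (range \<phi>)"
    using assms by (auto simp: mem_closeness mem_ray_end)
  note sub = coarse_ray_subset[OF rays(1)] coarse_ray_subset[OF rays(2)]
  have fray: "coarse_ray Y (f \<circ> \<phi>)" "coarse_ray Y (f \<circ> \<psi>)" "coarse_ray Y (g \<circ> \<psi>)"
    using fs rays coarse_ray_compose by blast+
  have "ray_end Y (f \<circ> \<phi>) = ray_end Y (f \<circ> \<psi>)"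
    using coarsely_in_image[OF fs(1) sub co(1)] coarsely_in_image[OF fs(1) sub(2,1) co(2)]
    unfolding ray_end_eq_iff[OF fray(1,2)] by (simp add: image_comp)
  also have "\<dots> = ray_end Y (g \<circ> \<psi>)"
  proof -
    obtain R where R: "\<forall>x\<in>mspace X. mdist Y (f x) (g x) \<le> R" using fg by (auto simp: mem_closeness)
    then have *: "mdist Y (f (\<psi> n)) (g (\<psi> n)) \<le> R" for n using sub(2) by blast
    then have **: "mdist Y (g (\<psi> n)) (f (\<psi> n)) \<le> R" for n by (simp add: mdist_commute)
    show ?thesis
      unfolding ray_end_eq_iff[OF fray(2,3)] coarsely_in_def using * ** by auto
  qed
  finally show ?thesis .
qed

lemma ends_map_class:
  assumes f: "coarse_map X Y f" and \<phi>: "coarse_ray X \<phi>"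
  shows "ends_map X Y (coarse_class X Y f) (ray_end X \<phi>) = ray_end Y (f \<circ> \<phi>)"
proof -
  have \<phi>\<phi>: "\<phi> \<in> ray_end X \<phi>"
    using \<phi> coarse_ray_subset[OF \<phi>] by (simp add: mem_ray_end coarsely_in_subset)
  have "ends_map X Y (coarse_class X Y f) (ray_end X \<phi>) =
      (\<Union>\<alpha>\<in>{g \<circ> \<psi> |g \<psi>. (f, g) \<in> closeness X Y \<and> \<psi> \<in> ray_end X \<phi>}. ray_end Y \<alpha>)"
    using ray_end_in_ends[OF \<phi>] by (auto simp: ends_map_def ray_end_def coarse_class_def)
  also have "\<dots> = ray_end Y (f \<circ> \<phi>)"
    using \<phi>\<phi> closeness_refl[OF f] ray_end_compose_eq[of f _ X Y _ \<phi>] by blast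
  finally show ?thesis .
qed

text \<open>
  Together with the preservation of closeness this is why a coarse map is uniformly continuous on
  ends: it maps the star with respect to the pulled back cover into the star with respect to the
  given one.
\<close>

lemma coarse_cover_vimage:
  assumes f: "coarse_map X Y f" and \<V>: "coarse_cover Y \<V>"
  shows "coarse_cover X ((\<lambda>V. f -` V \<inter> mspace X) ` \<V>)"
  unfolding coarse_cover_iff
proof (intro conjI allI)
  show "finite ((\<lambda>V. f -` V \<inter> mspace X) ` \<V>)" using \<V> by (simp add: coarse_cover_def)
  show "\<forall>U\<in>(\<lambda>V. f -` V \<inter> mspace X) ` \<V>. U \<subseteq> mspace X" by blast
  fix R
  obtain S where S: "\<And>x y. x \<in> mspace X \<Longrightarrow> y \<in> mspace X \<Longrightarrow> mdist X x y \<le> R \<Longrightarrow> mdist Y (f x) (f y) \<le> S"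
    using f unfolding coarse_map_iff by metis
  obtain B where B: "coarse_bounded Y B"
    "\<And>x y. x \<in> mspace Y - B \<Longrightarrow> y \<in> mspace Y \<Longrightarrow> mdist Y x y \<le> S \<Longrightarrow> \<exists>V\<in>\<V>. x \<in> V \<and> y \<in> V"
    using \<V> unfolding coarse_cover_iff by meson
  have "coarse_bounded X (f -` B \<inter> mspace X)" using f B(1) by (simp add: coarse_map_def)
  moreover have "\<exists>U\<in>(\<lambda>V. f -` V \<inter> mspace X) ` \<V>. x \<in> U \<and> y \<in> U"
    if xy: "x \<in> mspace X - (f -` B \<inter> mspace X)" "y \<in> mspace X" "mdist X x y \<le> R" for x y
  proof -
    have "f x \<in> mspace Y - B" "f y \<in> mspace Y" using f xy by (auto simp: coarse_map_def)
    moreover have "mdist Y (f x) (f y) \<le> S" using S xy by blast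
    ultimately obtain V where "V \<in> \<V>" "f x \<in> V" "f y \<in> V" using B(2)[of "f x" "f y"] by blast
    with xy show ?thesis by auto
  qed
  ultimately show "\<exists>B. coarse_bounded X B \<and> (\<forall>x\<in>mspace X - B. \<forall>y\<in>mspace X.
      mdist X x y \<le> R \<longrightarrow> (\<exists>U\<in>(\<lambda>V. f -` V \<inter> mspace X) ` \<V>. x \<in> U \<and> y \<in> U))"
    by blast
qed

lemma ends_map_in_Unif_hom:
  assumes f: "coarse_map X Y f"
  shows "ends_map X Y (coarse_class X Y f) \<in> Unif_hom (ends_space X) (ends_space Y)"
  unfolding Unif_hom_def fst_ends_space mem_Collect_eq
proof (intro conjI ballI)
  let ?F = "ends_map X Y (coarse_class X Y f)"
  show "?F \<in> ends X \<rightarrow>\<^sub>E ends Y"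
  proof (rule PiE_I)
    show "?F p \<in> ends Y" if "p \<in> ends X" for p
      using that by (rule endsE) (simp add: ends_map_class[OF f] ray_end_in_ends coarse_ray_compose[OF f])
    show "?F p = undefined" if "p \<notin> ends X" for p using that by (simp add: ends_map_def)
  qed
  fix D assume "D \<in> snd (ends_space Y)"
  then obtain \<V> where \<V>: "coarse_cover Y \<V>" "end_entourage Y \<V> \<subseteq> D"
    unfolding snd_ends_space by blast
  let ?\<U> = "(\<lambda>V. f -` V \<inter> mspace X) ` \<V>"
  have \<U>: "coarse_cover X ?\<U>" using f \<V>(1) by (rule coarse_cover_vimage)
  have star: "coarsely_in Y (f ` S) (coarse_star Y (f ` T) \<V>)"
    if "coarsely_in X S (coarse_star X T ?\<U>)" "S \<subseteq> mspace X" "T \<subseteq> mspace X" for S T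
  proof -
    have "f ` coarse_star X T ?\<U> \<subseteq> coarse_star Y (f ` T) \<V>"
    proof clarify
      fix x assume "x \<in> coarse_star X T ?\<U>"
      then obtain V where V: "V \<in> \<V>" "close_sets X T (f -` V \<inter> mspace X)" "f x \<in> V"
        unfolding coarse_star_def by blast
      have "V \<subseteq> mspace Y" using V \<V> by (auto simp: coarse_cover_def)
      moreover have "f ` T \<subseteq> mspace Y" using f that(3) by (auto simp: coarse_map_def)
      moreover have "close_sets Y (f ` T) (f ` (f -` V \<inter> mspace X))"
        using close_sets_image[OF f that(3) _ V(2)] by blast
      ultimately have "close_sets Y (f ` T) V" using close_sets_mono by (metis Int_lower1 image_subset_iff_subset_vimage)
      with V show "f x \<in> coarse_star Y (f ` T) \<V>" unfolding coarse_star_def by blast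
    qed
    then show ?thesis
      using coarsely_in_image[OF f that(2) coarse_star_subset[OF \<U>] that(1)] coarsely_in_mono by blast
  qed
  have "(?F p, ?F q) \<in> D" if pq: "(p, q) \<in> end_entourage X ?\<U>" for p q
  proof -
    obtain \<phi> \<psi> where \<phi>: "coarse_ray X \<phi>" "p = ray_end X \<phi>" and \<psi>: "coarse_ray X \<psi>" "q = ray_end X \<psi>"
      using end_entourage_subset pq by (metis endsE mem_Sigma_iff subsetD)
    note sub = coarse_ray_subset[OF \<phi>(1)] coarse_ray_subset[OF \<psi>(1)]
    note rays = coarse_ray_compose[OF f \<phi>(1)] coarse_ray_compose[OF f \<psi>(1)]
    have "coarsely_in X (range \<psi>) (coarse_star X (range \<phi>) ?\<U>)"
        "coarsely_in X (range \<phi>) (coarse_star X (range \<psi>) ?\<U>)"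
      using pq unfolding \<phi> \<psi> end_entourage_iff[OF \<phi>(1) \<psi>(1) \<U>] by auto
    then have "(ray_end Y (f \<circ> \<phi>), ray_end Y (f \<circ> \<psi>)) \<in> end_entourage Y \<V>"
      using star[of "range \<psi>" "range \<phi>"] star[of "range \<phi>" "range \<psi>"] sub
      unfolding end_entourage_iff[OF rays \<V>(1)] by (simp add: image_comp)
    then show ?thesis using \<V>(2) \<phi> \<psi> ends_map_class[OF f] by auto
  qed
  then have "end_entourage X ?\<U> \<subseteq> {(x, y) \<in> ends X \<times> ends X. (?F x, ?F y) \<in> D}"
    using end_entourage_subset by fastforce
  with \<U> show "{(x, y) \<in> ends X \<times> ends X. (?F x, ?F y) \<in> D} \<in> snd (ends_space X)"
    unfolding snd_ends_space by blast
qed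

lemma ends_map_compose:
  assumes "coarse_map X Y f" "coarse_map Y Z g" "p \<in> ends X"
  shows "ends_map Y Z (coarse_class Y Z g) (ends_map X Y (coarse_class X Y f) p) =
    ends_map X Z (coarse_class X Z (g \<circ> f)) p"
  using assms(3)
  by (rule endsE) (use assms(1,2) in \<open>simp add: ends_map_class coarse_ray_compose coarse_map_compose comp_assoc\<close>)

lemma ends_map_id: "p \<in> ends X \<Longrightarrow> ends_map X X (coarse_class X X id) p = p"
  by (erule endsE) (simp add: ends_map_class coarse_map_id)

lemma ends_map_in_ends: "coarse_map X Y f \<Longrightarrow> p \<in> ends X \<Longrightarrow> ends_map X Y (coarse_class X Y f) p \<in> ends Y"
  using ends_map_in_Unif_hom[of X Y f] by (auto simp: Unif_hom_def)

lemma Unif_hom_compose: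
  assumes f: "f \<in> Unif_hom U V" and g: "g \<in> Unif_hom V W"
  shows "compose (fst U) g f \<in> Unif_hom U W"
proof -
  have maps: "f \<in> fst U \<rightarrow>\<^sub>E fst V" "g \<in> fst V \<rightarrow>\<^sub>E fst W"
    using f g by (auto simp: Unif_hom_def)
  have "{(x, y) \<in> fst U \<times> fst U. (compose (fst U) g f x, compose (fst U) g f y) \<in> D} \<in> snd U"
    if D: "D \<in> snd W" for D
  proof -
    have "{(x, y) \<in> fst V \<times> fst V. (g x, g y) \<in> D} \<in> snd V" using g D by (simp add: Unif_hom_def)
    then have "{(x, y) \<in> fst U \<times> fst U. (f x, f y) \<in> {(x, y) \<in> fst V \<times> fst V. (g x, g y) \<in> D}} \<in> snd U"
      using f unfolding Unif_hom_def by blast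
    also have "{(x, y) \<in> fst U \<times> fst U. (f x, f y) \<in> {(x, y) \<in> fst V \<times> fst V. (g x, g y) \<in> D}} =
        {(x, y) \<in> fst U \<times> fst U. (compose (fst U) g f x, compose (fst U) g f y) \<in> D}"
      using maps by (auto simp: compose_def)
    finally show ?thesis .
  qed
  moreover have "compose (fst U) g f \<in> fst U \<rightarrow>\<^sub>E fst W"
    using maps by (auto simp: compose_def)
  ultimately show ?thesis by (simp add: Unif_hom_def)
qed

section \<open>A metric model of finite coproducts\<close>

text \<open>
  The summands are embedded isometrically, and the distance between points of distinct summands is
  the length of a path through both base points and a connecting edge of length 1. An empty summand
  has no base point and contributes no points.
\<close>

locale metric_coproduct =
  fixes I :: "'i set" and X :: "'i \<Rightarrow> 'a metric" and Z :: "'b metric"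
    and inc :: "'i \<Rightarrow> 'a \<Rightarrow> 'b" and b :: "'i \<Rightarrow> 'a"
  assumes finite_index: "finite I"
    and base: "i \<in> I \<Longrightarrow> mspace (X i) \<noteq> {} \<Longrightarrow> b i \<in> mspace (X i)"
    and mspace_coproduct: "mspace Z = (\<Union>i\<in>I. inc i ` mspace (X i))"
    and mdist_same: "i \<in> I \<Longrightarrow> x \<in> mspace (X i) \<Longrightarrow> y \<in> mspace (X i) \<Longrightarrow>
          mdist Z (inc i x) (inc i y) = mdist (X i) x y"
    and mdist_distinct: "i \<in> I \<Longrightarrow> j \<in> I \<Longrightarrow> i \<noteq> j \<Longrightarrow> x \<in> mspace (X i) \<Longrightarrow> y \<in> mspace (X j) \<Longrightarrow>
          mdist Z (inc i x) (inc j y) = mdist (X i) (b i) x + 1 + mdist (X j) (b j) y"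
begin

lemma mspace_coproductE:
  assumes "z \<in> mspace Z"
  obtains i x where "i \<in> I" "x \<in> mspace (X i)" "z = inc i x"
  using assms mspace_coproduct by blast

lemma inc_in: "i \<in> I \<Longrightarrow> x \<in> mspace (X i) \<Longrightarrow> inc i x \<in> mspace Z"
  using mspace_coproduct by blast

lemma inc_image_subset: "i \<in> I \<Longrightarrow> A \<subseteq> mspace (X i) \<Longrightarrow> inc i ` A \<subseteq> mspace Z"
  using inc_in by blast

lemma inc_eq_iff:
  assumes "i \<in> I" "j \<in> I" "x \<in> mspace (X i)" "y \<in> mspace (X j)"
  shows "inc i x = inc j y \<longleftrightarrow> i = j \<and> x = y"
proof
  assume eq: "inc i x = inc j y"
  then have "mdist Z (inc i x) (inc j y) = 0" using inc_in assms by simp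
  then show "i = j \<and> x = y"
    using mdist_same[of i x y] mdist_distinct[of i j x y] assms
      mdist_nonneg[of "X i" "b i" x] mdist_nonneg[of "X j" "b j" y]
    by (cases "i = j") auto
qed simp

lemma coarse_bounded_inc_image:
  assumes "i \<in> I" "A \<subseteq> mspace (X i)"
  shows "coarse_bounded Z (inc i ` A) \<longleftrightarrow> coarse_bounded (X i) A"
proof -
  have "mdist Z (inc i x) (inc i y) = mdist (X i) x y" if "x \<in> A" "y \<in> A" for x y
    using that assms mdist_same by blast
  then show ?thesis
    using assms inc_image_subset[OF assms] unfolding coarse_bounded_diameter by simp
qed

lemma coarse_map_inc:
  assumes i: "i \<in> I"
  shows "coarse_map (X i) Z (inc i)"
  unfolding coarse_map_iff
proof (intro conjI allI impI)
  show "inc i \<in> mspace (X i) \<rightarrow> mspace Z" using inc_in i by blast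
  show "\<exists>S. \<forall>x\<in>mspace (X i). \<forall>y\<in>mspace (X i). mdist (X i) x y \<le> R \<longrightarrow> mdist Z (inc i x) (inc i y) \<le> S" for R
    by (intro exI[of _ R]) (simp add: mdist_same i)
  fix B assume "coarse_bounded Z B"
  then have "coarse_bounded Z (inc i ` (inc i -` B \<inter> mspace (X i)))"
    by (rule coarse_bounded_subset) auto
  then show "coarse_bounded (X i) (inc i -` B \<inter> mspace (X i))"
    using coarse_bounded_inc_image[OF i] by simp
qed

text \<open>
  Two points at distance at most \<open>R\<close>, one of which lies outside \<open>core R\<close>, belong to the same
  summand. This bounded set is the only region where summands interact at scale \<open>R\<close>.
\<close>

definition core :: "real \<Rightarrow> 'b set" where
  "core R = (\<Union>i\<in>I. inc i ` {x \<in> mspace (X i). mdist (X i) (b i) x \<le> R})"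

lemma coarse_bounded_core: "coarse_bounded Z (core R)"
  unfolding core_def
proof (rule coarse_bounded_UN[OF finite_index])
  fix i assume i: "i \<in> I"
  have "coarse_bounded (X i) {x \<in> mspace (X i). mdist (X i) (b i) x \<le> R}"
  proof (cases "mspace (X i) = {}")
    case True
    then show ?thesis by simp
  next
    case False
    then show ?thesis using coarse_bounded_iff[OF base[OF i]] by auto
  qed
  then show "coarse_bounded Z (inc i ` {x \<in> mspace (X i). mdist (X i) (b i) x \<le> R})"
    using coarse_bounded_inc_image[OF i] by simp
qed

lemma same_summand:
  assumes "i \<in> I" "j \<in> I" "x \<in> mspace (X i)" "y \<in> mspace (X j)"
    and "mdist Z (inc i x) (inc j y) \<le> R" "inc i x \<notin> core R"
  shows "i = j"
proof (rule ccontr)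
  assume "i \<noteq> j"
  then have "mdist (X i) (b i) x \<le> R"
    using mdist_distinct[OF assms(1,2) _ assms(3,4)] assms(5) mdist_nonneg[of "X j" "b j" y] by linarith
  then have "inc i x \<in> core R" using assms by (auto simp: core_def)
  with assms show False by blast
qed

lemma unbounded_outside_core:
  assumes "i \<in> I" "S \<subseteq> mspace (X i)" "\<not> coarse_bounded (X i) S"
  obtains s where "s \<in> S" "inc i s \<notin> core R"
proof -
  have "\<not> inc i ` S \<subseteq> core R"
    using coarse_bounded_subset[OF coarse_bounded_core] coarse_bounded_inc_image assms by blast
  then show ?thesis using that by blast
qed

text \<open>
  An unbounded set has a point outside \<open>core R\<close>, which forces the two summands to agree; inside one
  summand the inclusion is isometric.
\<close>

lemma coarsely_in_inc_images:
  assumes ij: "i \<in> I" "j \<in> I" and S: "S \<subseteq> mspace (X i)" "\<not> coarse_bounded (X i) S"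
    and T: "T \<subseteq> mspace (X j)" and co: "coarsely_in Z (inc i ` S) (inc j ` T)"
  shows "i = j" "coarsely_in (X i) S T"
proof -
  obtain R where R: "\<And>s. s \<in> S \<Longrightarrow> \<exists>t\<in>T. mdist Z (inc i s) (inc j t) \<le> R"
    using co unfolding coarsely_in_def by blast
  obtain s where s: "s \<in> S" "inc i s \<notin> core R" using unbounded_outside_core ij(1) S by blast
  obtain t where t: "t \<in> T" "mdist Z (inc i s) (inc j t) \<le> R" using R s(1) by blast
  show eq: "i = j"
    by (rule same_summand[OF ij, of s t R]) (use s t S T in auto)
  have "mdist Z (inc i s) (inc j t) = mdist (X i) s t" if "s \<in> S" "t \<in> T" for s t
    using mdist_same[OF ij(1)] eq that S T by blast
  then show "coarsely_in (X i) S T" unfolding coarsely_in_def using R by (intro exI[of _ R]) fastforce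
qed

lemma close_sets_inc_images:
  assumes ij: "i \<in> I" "j \<in> I" and S: "S \<subseteq> mspace (X i)" and T: "T \<subseteq> mspace (X j)"
    and cl: "close_sets Z (inc i ` S) (inc j ` T)"
  shows "i = j" "close_sets (X i) S T"
proof -
  obtain R where R: "\<not> coarse_bounded Z {a \<in> inc i ` S. \<exists>b\<in>inc j ` T. mdist Z a b \<le> R}"
    using cl close_sets_iff[OF inc_image_subset[OF ij(1) S] inc_image_subset[OF ij(2) T]] by blast
  then have "\<not> {a \<in> inc i ` S. \<exists>b\<in>inc j ` T. mdist Z a b \<le> R} \<subseteq> core R"
    using coarse_bounded_subset[OF coarse_bounded_core] by blast
  then obtain s t where st: "s \<in> S" "t \<in> T" "mdist Z (inc i s) (inc j t) \<le> R" "inc i s \<notin> core R"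
    by blast
  show eq: "i = j"
    by (rule same_summand[OF ij, of s t R]) (use st S T in auto)
  have "mdist Z (inc i s) (inc j t) = mdist (X i) s t" if "s \<in> S" "t \<in> T" for s t
    using mdist_same[OF ij(1)] eq that S T by blast
  then have "{a \<in> inc i ` S. \<exists>b\<in>inc j ` T. mdist Z a b \<le> R} = inc i ` {s \<in> S. \<exists>t\<in>T. mdist (X i) s t \<le> R}"
    by (auto intro!: imageI)
  with R have "\<not> coarse_bounded (X i) {s \<in> S. \<exists>t\<in>T. mdist (X i) s t \<le> R}"
    using coarse_bounded_inc_image[OF ij(1), of "{s \<in> S. \<exists>t\<in>T. mdist (X i) s t \<le> R}"] S by auto
  then show "close_sets (X i) S T"
    using close_sets_iff[OF S, of T] T eq by blast
qed

text \<open>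
  For the glued map to preserve entourages, \<open>R\<close>-close points of distinct summands must have images at
  bounded distance: both points lie in \<open>core R\<close>, and the images of the finitely many balls that
  form it are bounded.
\<close>

lemma coarse_copairing:
  assumes f: "\<And>i. i \<in> I \<Longrightarrow> coarse_map (X i) Y (f i)"
  obtains k where "coarse_map Z Y k" "\<And>i x. i \<in> I \<Longrightarrow> x \<in> mspace (X i) \<Longrightarrow> k (inc i x) = f i x"
proof -
  define k where "k z = (SOME y. \<exists>i\<in>I. \<exists>x\<in>mspace (X i). z = inc i x \<and> y = f i x)" for z
  have k: "k (inc i x) = f i x" if ix: "i \<in> I" "x \<in> mspace (X i)" for i x
  proof -
    have "\<exists>i'\<in>I. \<exists>x'\<in>mspace (X i'). inc i x = inc i' x' \<and> k (inc i x) = f i' x'"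
      unfolding k_def by (rule someI[of _ "f i x"]) (use ix in blast)
    then show ?thesis using inc_eq_iff ix by auto
  qed
  have fY: "f i x \<in> mspace Y" if "i \<in> I" "x \<in> mspace (X i)" for i x
    using f[OF that(1)] that(2) by (auto simp: coarse_map_def)
  have "coarse_map Z Y k"
    unfolding coarse_map_iff
  proof (intro conjI allI impI)
    show "k \<in> mspace Z \<rightarrow> mspace Y"
      using fY by (auto simp: mspace_coproduct k)
  next
    fix R
    have "\<forall>i\<in>I. \<exists>S. \<forall>x\<in>mspace (X i). \<forall>y\<in>mspace (X i). mdist (X i) x y \<le> R \<longrightarrow> mdist Y (f i x) (f i y) \<le> S"
      using f unfolding coarse_map_iff by blast
    then obtain S where S: "\<And>i x y. i \<in> I \<Longrightarrow> x \<in> mspace (X i) \<Longrightarrow> y \<in> mspace (X i) \<Longrightarrow>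
        mdist (X i) x y \<le> R \<Longrightarrow> mdist Y (f i x) (f i y) \<le> S i"
      by (metis bchoice)
    let ?K = "\<Union>i\<in>I. f i ` {x \<in> mspace (X i). mdist (X i) (b i) x \<le> R}"
    have "coarse_bounded Y (f i ` {x \<in> mspace (X i). mdist (X i) (b i) x \<le> R})" if i: "i \<in> I" for i
    proof (cases "mspace (X i) = {}")
      case True
      then show ?thesis by simp
    next
      case False
      then have bi: "b i \<in> mspace (X i)" using base i by blast
      have "mdist Y (f i (b i)) y \<le> S i" if "y \<in> f i ` {x \<in> mspace (X i). mdist (X i) (b i) x \<le> R}" for y
        using that S[OF i bi] by blast
      then show ?thesis
        using coarse_bounded_iff[OF fY[OF i bi]] fY[OF i] by blast
    qed
    then have "coarse_bounded Y ?K" using finite_index by (intro coarse_bounded_UN)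
    then obtain D where D: "\<forall>x\<in>?K. \<forall>y\<in>?K. mdist Y x y \<le> D"
      unfolding coarse_bounded_diameter by blast
    define M where "M = Max (insert D (S ` I))"
    have M: "D \<le> M" "\<And>i. i \<in> I \<Longrightarrow> S i \<le> M" using finite_index by (auto simp: M_def)
    have "mdist Y (k z) (k w) \<le> M" if zw: "z \<in> mspace Z" "w \<in> mspace Z" "mdist Z z w \<le> R" for z w
    proof -
      obtain i x where ix: "i \<in> I" "x \<in> mspace (X i)" "z = inc i x"
        using zw(1) by (rule mspace_coproductE)
      obtain j y where jy: "j \<in> I" "y \<in> mspace (X j)" "w = inc j y"
        using zw(2) by (rule mspace_coproductE)
      show ?thesis
      proof (cases "i = j")
        case True
        then have "mdist Y (f i x) (f i y) \<le> S i"
          using S[of i x y] mdist_same[of i x y] ix jy zw by simp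
        then show ?thesis using True M(2)[OF ix(1)] k ix jy by fastforce
      next
        case False
        then have "mdist (X i) (b i) x + 1 + mdist (X j) (b j) y \<le> R"
          using mdist_distinct[of i j x y] ix jy zw by simp
        then have "mdist (X i) (b i) x \<le> R" "mdist (X j) (b j) y \<le> R"
          using mdist_nonneg[of "X i" "b i" x] mdist_nonneg[of "X j" "b j" y] by linarith+
        then have "f i x \<in> ?K" "f j y \<in> ?K" using ix jy by auto
        then have "mdist Y (f i x) (f j y) \<le> D" using D by blast
        then show ?thesis using M(1) k ix jy by fastforce
      qed
    qed
    then show "\<exists>S. \<forall>x\<in>mspace Z. \<forall>y\<in>mspace Z. mdist Z x y \<le> R \<longrightarrow> mdist Y (k x) (k y) \<le> S" by blast
  next
    fix B assume B: "coarse_bounded Y B"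
    have "coarse_bounded Z (\<Union>i\<in>I. inc i ` (f i -` B \<inter> mspace (X i)))"
    proof (rule coarse_bounded_UN[OF finite_index])
      fix i assume i: "i \<in> I"
      then have "coarse_bounded (X i) (f i -` B \<inter> mspace (X i))"
        using f B by (auto simp: coarse_map_def)
      then show "coarse_bounded Z (inc i ` (f i -` B \<inter> mspace (X i)))"
        using coarse_bounded_inc_image[OF i] by simp
    qed
    moreover have "k -` B \<inter> mspace Z \<subseteq> (\<Union>i\<in>I. inc i ` (f i -` B \<inter> mspace (X i)))"
    proof
      fix z assume z: "z \<in> k -` B \<inter> mspace Z"
      then obtain i x where ix: "i \<in> I" "x \<in> mspace (X i)" "z = inc i x" using mspace_coproduct by blast
      then have "f i x \<in> B" using z k by auto
      with ix show "z \<in> (\<Union>i\<in>I. inc i ` (f i -` B \<inter> mspace (X i)))" by blast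
    qed
    ultimately show "coarse_bounded Z (k -` B \<inter> mspace Z)" by (rule coarse_bounded_subset)
  qed
  with k show ?thesis using that by blast
qed

text \<open>
  After finitely many steps the ray avoids \<open>core R\<close>, where \<open>R\<close> bounds its step length. From then on
  consecutive points lie in the same summand. Dropping the initial part does not change the end.
\<close>

lemma ray_eventually_in_summand:
  assumes \<phi>: "coarse_ray Z \<phi>"
  obtains i \<psi> where "i \<in> I" "coarse_ray (X i) \<psi>" "ray_end Z \<phi> = ray_end Z (inc i \<circ> \<psi>)"
proof -
  note ray = \<phi>[unfolded coarse_ray_def coarse_map_iff, simplified]
  obtain R where R: "\<And>m n. \<bar>real m - real n\<bar> \<le> 1 \<Longrightarrow> mdist Z (\<phi> m) (\<phi> n) \<le> R"
    using ray by metis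
  have "finite (\<phi> -` core R)"
    using ray coarse_bounded_core coarse_bounded_Z_plus by blast
  then obtain N where N: "\<And>n. n \<in> \<phi> -` core R \<Longrightarrow> n < N"
    using finite_nat_set_iff_bounded[of "\<phi> -` core R"] by auto
  have in_Z: "\<phi> n \<in> mspace Z" for n using ray by blast
  obtain i where i: "i \<in> I" "\<phi> N \<in> inc i ` mspace (X i)"
    using in_Z[of N] mspace_coproduct by blast
  have tail: "\<phi> (N + n) \<in> inc i ` mspace (X i)" for n
  proof (induction n)
    case 0
    then show ?case using i by simp
  next
    case (Suc n)
    then obtain x where x: "x \<in> mspace (X i)" "\<phi> (N + n) = inc i x" by blast
    obtain j y where y: "j \<in> I" "y \<in> mspace (X j)" "\<phi> (N + Suc n) = inc j y"
      using in_Z[of "N + Suc n"] mspace_coproduct by blast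
    have "mdist Z (\<phi> (N + n)) (\<phi> (N + Suc n)) \<le> R" by (rule R) simp
    moreover have "\<phi> (N + n) \<notin> core R" using N[of "N + n"] by auto
    ultimately have "i = j" using same_summand[OF i(1) y(1) x(1) y(2)] x y by simp
    with y show ?case by blast
  qed
  define \<psi> where "\<psi> n = inv_into (mspace (X i)) (inc i) (\<phi> (N + n))" for n
  have \<psi>: "\<psi> n \<in> mspace (X i)" "inc i (\<psi> n) = \<phi> (N + n)" for n
    using tail[of n] by (auto simp: \<psi>_def inv_into_into f_inv_into_f)
  have "coarse_map Z_plus Z_plus (\<lambda>n. N + n)"
    unfolding coarse_map_iff
  proof (intro conjI allI impI)
    show "\<exists>S. \<forall>x\<in>mspace Z_plus. \<forall>y\<in>mspace Z_plus. mdist Z_plus x y \<le> r \<longrightarrow> mdist Z_plus (N + x) (N + y) \<le> S" for r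
      by (intro exI[of _ r]) simp
    fix B :: "nat set" assume "coarse_bounded Z_plus B"
    then show "coarse_bounded Z_plus ((\<lambda>n. N + n) -` B \<inter> mspace Z_plus)"
      by (auto simp: coarse_bounded_Z_plus intro!: finite_vimageI)
  qed simp
  then have "coarse_map Z_plus Z (\<phi> \<circ> (\<lambda>n. N + n))"
    using \<phi> unfolding coarse_ray_def by (rule coarse_map_compose)
  moreover have eq: "\<phi> \<circ> (\<lambda>n. N + n) = inc i \<circ> \<psi>" using \<psi> by auto
  ultimately have inc\<psi>: "coarse_map Z_plus Z (inc i \<circ> \<psi>)" by simp
  have \<psi>_ray: "coarse_ray (X i) \<psi>"
    unfolding coarse_ray_def coarse_map_iff
  proof (intro conjI allI impI)
    show "\<psi> \<in> mspace Z_plus \<rightarrow> mspace (X i)" using \<psi> by blast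
    show "\<exists>S. \<forall>x\<in>mspace Z_plus. \<forall>y\<in>mspace Z_plus. mdist Z_plus x y \<le> r \<longrightarrow> mdist (X i) (\<psi> x) (\<psi> y) \<le> S" for r
    proof -
      have "mdist (X i) (\<psi> x) (\<psi> y) = mdist Z ((inc i \<circ> \<psi>) x) ((inc i \<circ> \<psi>) y)" for x y
        using mdist_same[OF i(1)] \<psi>(1) by simp
      then show ?thesis using inc\<psi> unfolding coarse_map_iff by simp
    qed
    fix B assume B: "coarse_bounded (X i) B"
    then have "B \<subseteq> mspace (X i)" by (simp add: coarse_bounded_def)
    then have "coarse_bounded Z (inc i ` B)" using B coarse_bounded_inc_image[OF i(1)] by blast
    then have "coarse_bounded Z_plus ((inc i \<circ> \<psi>) -` (inc i ` B) \<inter> mspace Z_plus)"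
      using inc\<psi> by (simp only: coarse_map_def)
    then show "coarse_bounded Z_plus (\<psi> -` B \<inter> mspace Z_plus)"
      by (rule coarse_bounded_subset) auto
  qed
  have "range \<phi> - \<phi> ` {..<N} \<subseteq> range (inc i \<circ> \<psi>)"
  proof
    fix z assume z: "z \<in> range \<phi> - \<phi> ` {..<N}"
    then obtain n where "z = \<phi> n" "\<not> n < N" by auto
    then have "z = (inc i \<circ> \<psi>) (n - N)" using \<psi>(2)[of "n - N"] by simp
    then show "z \<in> range (inc i \<circ> \<psi>)" by blast
  qed
  moreover have sub: "range \<phi> \<subseteq> mspace Z" "range (inc i \<circ> \<psi>) \<subseteq> mspace Z"
    using coarse_ray_subset[OF \<phi>] coarse_ray_subset[of Z "inc i \<circ> \<psi>"] inc\<psi> by (auto simp: coarse_ray_def)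
  ultimately have "coarsely_in Z (range \<phi> - \<phi> ` {..<N}) (range (inc i \<circ> \<psi>))"
    by (intro coarsely_in_subset) auto
  moreover have "coarse_bounded Z (\<phi> ` {..<N})"
    using in_Z by (intro coarse_bounded_finite) auto
  ultimately have "coarsely_in Z (range \<phi>) (range (inc i \<circ> \<psi>))"
    using coarsely_in_diff_bounded sub coarse_ray_unbounded[OF \<phi>] by blast
  moreover have "coarsely_in Z (range (inc i \<circ> \<psi>)) (range \<phi>)"
    using sub(2) by (intro coarsely_in_subset) (auto simp: \<psi>(2))
  ultimately have "ray_end Z \<phi> = ray_end Z (inc i \<circ> \<psi>)"
    using ray_end_eq_iff[OF \<phi>] inc\<psi> by (simp add: coarse_ray_def)
  with i(1) \<psi>_ray show ?thesis by (rule that)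
qed

abbreviation inc_ends :: "'i \<Rightarrow> (nat \<Rightarrow> 'a) set \<Rightarrow> (nat \<Rightarrow> 'b) set" where
  "inc_ends i \<equiv> ends_map (X i) Z (coarse_class (X i) Z (inc i))"

lemma inc_ends_surj:
  assumes "p \<in> ends Z"
  obtains i q where "i \<in> I" "q \<in> ends (X i)" "p = inc_ends i q"
proof -
  obtain \<phi> where \<phi>: "coarse_ray Z \<phi>" "p = ray_end Z \<phi>" using assms by (rule endsE)
  obtain i \<psi> where "i \<in> I" "coarse_ray (X i) \<psi>" "ray_end Z \<phi> = ray_end Z (inc i \<circ> \<psi>)"
    using \<phi>(1) by (rule ray_eventually_in_summand)
  then show ?thesis
    using that ray_end_in_ends ends_map_class[OF coarse_map_inc] \<phi>(2) by metis
qed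

lemma inc_ends_inject:
  assumes ij: "i \<in> I" "j \<in> I" and p: "p \<in> ends (X i)" and q: "q \<in> ends (X j)"
    and eq: "inc_ends i p = inc_ends j q"
  shows "i = j \<and> p = q"
proof -
  obtain \<phi> where \<phi>: "coarse_ray (X i) \<phi>" "p = ray_end (X i) \<phi>" using p by (rule endsE)
  obtain \<psi> where \<psi>: "coarse_ray (X j) \<psi>" "q = ray_end (X j) \<psi>" using q by (rule endsE)
  have rays: "coarse_ray Z (inc i \<circ> \<phi>)" "coarse_ray Z (inc j \<circ> \<psi>)"
    using coarse_ray_compose coarse_map_inc ij \<phi>(1) \<psi>(1) by blast+
  have "ray_end Z (inc i \<circ> \<phi>) = ray_end Z (inc j \<circ> \<psi>)"
    using eq ends_map_class[OF coarse_map_inc[OF ij(1)] \<phi>(1)] ends_map_class[OF coarse_map_inc[OF ij(2)] \<psi>(1)]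
      \<phi>(2) \<psi>(2) by simp
  then have co: "coarsely_in Z (inc i ` range \<phi>) (inc j ` range \<psi>)" "coarsely_in Z (inc j ` range \<psi>) (inc i ` range \<phi>)"
    unfolding ray_end_eq_iff[OF rays] by (simp_all add: image_comp)
  note sub = coarse_ray_subset[OF \<phi>(1)] coarse_ray_subset[OF \<psi>(1)]
  note unb = coarse_ray_unbounded[OF \<phi>(1)] coarse_ray_unbounded[OF \<psi>(1)]
  have "i = j" "coarsely_in (X i) (range \<phi>) (range \<psi>)"
    using coarsely_in_inc_images[OF ij sub(1) unb(1) sub(2) co(1)] by auto
  moreover have "coarsely_in (X j) (range \<psi>) (range \<phi>)"
    using coarsely_in_inc_images(2)[OF ij(2,1) sub(2) unb(2) sub(1) co(2)] .
  ultimately show ?thesis using \<phi> \<psi> ray_end_eq_iff by metis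
qed

lemma coarse_cover_inc_images:
  assumes \<U>: "\<And>i. i \<in> I \<Longrightarrow> coarse_cover (X i) (\<U> i)"
  shows "coarse_cover Z (\<Union>i\<in>I. (`) (inc i) ` \<U> i)" (is "coarse_cover Z ?\<W>")
  unfolding coarse_cover_iff
proof (intro conjI allI)
  show "finite ?\<W>" using finite_index \<U> by (auto simp: coarse_cover_def)
  show "\<forall>U\<in>?\<W>. U \<subseteq> mspace Z"
  proof
    fix W assume "W \<in> ?\<W>"
    then obtain i U where iU: "i \<in> I" "U \<in> \<U> i" "W = inc i ` U" by blast
    then have "U \<subseteq> mspace (X i)" using \<U> by (auto simp: coarse_cover_def)
    with iU show "W \<subseteq> mspace Z" using inc_image_subset by blast
  qed
  fix R
  have "\<forall>i\<in>I. \<exists>B. coarse_bounded (X i) B \<and> (\<forall>x\<in>mspace (X i) - B. \<forall>y\<in>mspace (X i).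
      mdist (X i) x y \<le> R \<longrightarrow> (\<exists>U\<in>\<U> i. x \<in> U \<and> y \<in> U))"
    using \<U>[unfolded coarse_cover_iff, THEN conjunct2, THEN conjunct2, THEN spec[of _ R]] by (rule ballI)
  then obtain B where B: "\<forall>i\<in>I. coarse_bounded (X i) (B i) \<and> (\<forall>x\<in>mspace (X i) - B i. \<forall>y\<in>mspace (X i).
      mdist (X i) x y \<le> R \<longrightarrow> (\<exists>U\<in>\<U> i. x \<in> U \<and> y \<in> U))"
    by (elim bchoice[THEN exE])
  let ?B = "core R \<union> (\<Union>i\<in>I. inc i ` B i)"
  have "coarse_bounded Z (inc i ` B i)" if "i \<in> I" for i
    using B that coarse_bounded_inc_image[OF that, of "B i"] by (auto simp: coarse_bounded_def)
  then have bounded: "coarse_bounded Z ?B"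
    by (intro coarse_bounded_Un coarse_bounded_core coarse_bounded_UN finite_index)
  have common: "\<exists>W\<in>?\<W>. z \<in> W \<and> w \<in> W"
    if zw: "z \<in> mspace Z - ?B" "w \<in> mspace Z" "mdist Z z w \<le> R" for z w
  proof -
    obtain i x where ix: "i \<in> I" "x \<in> mspace (X i)" "z = inc i x"
      using DiffD1[OF zw(1)] by (rule mspace_coproductE)
    obtain j y where jy: "j \<in> I" "y \<in> mspace (X j)" "w = inc j y"
      using zw(2) by (rule mspace_coproductE)
    have "z \<notin> core R" using zw(1) by blast
    then have "i = j" using same_summand[OF ix(1) jy(1) ix(2) jy(2)] zw(3) ix(3) jy(3) by simp
    then have "mdist (X i) x y \<le> R" "y \<in> mspace (X i)" "w = inc i y"
      using mdist_same[of i x y] ix jy zw by auto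
    moreover have "x \<in> mspace (X i) - B i" using zw ix by blast
    ultimately obtain U where "U \<in> \<U> i" "x \<in> U" "y \<in> U"
      using bspec[OF conjunct2[OF bspec[OF B ix(1)]], of x] by blast
    with ix(1,3) \<open>w = inc i y\<close> show ?thesis by (intro bexI[of _ "inc i ` U"]) auto
  qed
  show "\<exists>B. coarse_bounded Z B \<and>
      (\<forall>x\<in>mspace Z - B. \<forall>y\<in>mspace Z. mdist Z x y \<le> R \<longrightarrow> (\<exists>W\<in>?\<W>. x \<in> W \<and> y \<in> W))"
    by (rule exI[of _ ?B], intro conjI ballI impI bounded common)
qed

text \<open>
  A member coming from another summand is never close to a subset of this summand, so
  the star with respect to the combined cover is computed in the summand.
\<close>

lemma coarse_star_inc_image:
  assumes \<U>: "\<And>i. i \<in> I \<Longrightarrow> coarse_cover (X i) (\<U> i)" and i: "i \<in> I" and S: "S \<subseteq> mspace (X i)"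
  shows "coarse_star Z (inc i ` S) (\<Union>i\<in>I. (`) (inc i) ` \<U> i) \<subseteq> inc i ` coarse_star (X i) S (\<U> i)"
proof
  fix z assume "z \<in> coarse_star Z (inc i ` S) (\<Union>i\<in>I. (`) (inc i) ` \<U> i)"
  then obtain j U where j: "j \<in> I" "U \<in> \<U> j" "close_sets Z (inc i ` S) (inc j ` U)" "z \<in> inc j ` U"
    unfolding coarse_star_def by blast
  have U: "U \<subseteq> mspace (X j)" using \<U> j by (auto simp: coarse_cover_def)
  have "i = j" "close_sets (X i) S U" using close_sets_inc_images[OF i j(1) S U j(3)] by auto
  with j show "z \<in> inc i ` coarse_star (X i) S (\<U> i)" unfolding coarse_star_def by blast
qed

text \<open>
  Since each star stays in the summand of its ray, two ends that are near with respect to the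
  combined cover come from one summand and are near there.
\<close>

lemma end_entourage_inc_images:
  assumes \<U>: "\<And>i. i \<in> I \<Longrightarrow> coarse_cover (X i) (\<U> i)"
    and pq: "(p, q) \<in> end_entourage Z (\<Union>i\<in>I. (`) (inc i) ` \<U> i)"
  obtains i p' q' where "i \<in> I" "(p', q') \<in> end_entourage (X i) (\<U> i)" "p = inc_ends i p'" "q = inc_ends i q'"
proof -
  let ?\<W> = "\<Union>i\<in>I. (`) (inc i) ` \<U> i"
  have \<W>: "coarse_cover Z ?\<W>" using \<U> by (rule coarse_cover_inc_images)
  have pZ: "p \<in> ends Z" and qZ: "q \<in> ends Z" using pq end_entourage_subset by blast+
  obtain i p' where i: "i \<in> I" "p' \<in> ends (X i)" "p = inc_ends i p'" using pZ by (rule inc_ends_surj)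
  obtain j q' where j: "j \<in> I" "q' \<in> ends (X j)" "q = inc_ends j q'" using qZ by (rule inc_ends_surj)
  obtain \<phi> where \<phi>: "coarse_ray (X i) \<phi>" "p' = ray_end (X i) \<phi>" using i(2) by (rule endsE)
  obtain \<psi> where \<psi>: "coarse_ray (X j) \<psi>" "q' = ray_end (X j) \<psi>" using j(2) by (rule endsE)
  have rays: "coarse_ray Z (inc i \<circ> \<phi>)" "coarse_ray Z (inc j \<circ> \<psi>)"
    using coarse_ray_compose coarse_map_inc i(1) j(1) \<phi>(1) \<psi>(1) by blast+
  have "p = ray_end Z (inc i \<circ> \<phi>)" "q = ray_end Z (inc j \<circ> \<psi>)"
    using ends_map_class[OF coarse_map_inc] i j \<phi> \<psi> by simp_all
  then have co: "coarsely_in Z (inc j ` range \<psi>) (coarse_star Z (inc i ` range \<phi>) ?\<W>)"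
      "coarsely_in Z (inc i ` range \<phi>) (coarse_star Z (inc j ` range \<psi>) ?\<W>)"
    using pq unfolding end_entourage_iff[OF rays \<W>, symmetric] by (simp_all add: image_comp end_entourage_iff[OF rays \<W>])
  note sub = coarse_ray_subset[OF \<phi>(1)] coarse_ray_subset[OF \<psi>(1)]
  note unb = coarse_ray_unbounded[OF \<phi>(1)] coarse_ray_unbounded[OF \<psi>(1)]
  have "coarsely_in Z (inc j ` range \<psi>) (inc i ` coarse_star (X i) (range \<phi>) (\<U> i))"
    using co(1) by (rule coarsely_in_mono) (use \<U> coarse_star_inc_image i(1) sub(1) in blast)
  then have "j = i" and 1: "coarsely_in (X j) (range \<psi>) (coarse_star (X i) (range \<phi>) (\<U> i))"
    using coarsely_in_inc_images[OF j(1) i(1) sub(2) unb(2) coarse_star_subset[OF \<U>[OF i(1)]]] by blast+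
  have "coarsely_in Z (inc i ` range \<phi>) (inc j ` coarse_star (X j) (range \<psi>) (\<U> j))"
    using co(2) by (rule coarsely_in_mono) (use \<U> coarse_star_inc_image j(1) sub(2) in blast)
  then have 2: "coarsely_in (X i) (range \<phi>) (coarse_star (X j) (range \<psi>) (\<U> j))"
    using coarsely_in_inc_images(2)[OF i(1) j(1) sub(1) unb(1) coarse_star_subset[OF \<U>[OF j(1)]]] by blast
  have "(p', q') \<in> end_entourage (X i) (\<U> i)"
    using end_entourage_iff[OF \<phi>(1) _ \<U>[OF i(1)], of \<psi>] \<phi> \<psi> 1 2 \<open>j = i\<close> by simp
  then show ?thesis using that i j \<open>j = i\<close> by blast
qed

text \<open>
  On sets the glued map exists because the ends of the model are the disjoint union of the ends of
  the summands. It is uniformly continuous because covers chosen separately on the summands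
  combine to a cover of the model.
\<close>

lemma Unif_copairing:
  assumes g: "\<And>i. i \<in> I \<Longrightarrow> g i \<in> Unif_hom (ends_space (X i)) W"
  obtains u where "u \<in> Unif_hom (ends_space Z) W"
    "\<And>i q. i \<in> I \<Longrightarrow> q \<in> ends (X i) \<Longrightarrow> u (inc_ends i q) = g i q"
proof -
  define u where "u = (\<lambda>p\<in>ends Z. SOME w. \<exists>i\<in>I. \<exists>q\<in>ends (X i). p = inc_ends i q \<and> w = g i q)"
  have u: "u (inc_ends i q) = g i q" if iq: "i \<in> I" "q \<in> ends (X i)" for i q
  proof -
    have "inc_ends i q \<in> ends Z" using ends_map_in_ends[OF coarse_map_inc] iq by blast
    moreover have "\<exists>j\<in>I. \<exists>r\<in>ends (X j). inc_ends i q = inc_ends j r \<and>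
        (SOME w. \<exists>j\<in>I. \<exists>r\<in>ends (X j). inc_ends i q = inc_ends j r \<and> w = g j r) = g j r"
      by (rule someI[of _ "g i q"]) (use iq in blast)
    ultimately show ?thesis using inc_ends_inject[OF iq(1) _ iq(2)] unfolding u_def by fastforce
  qed
  have "u \<in> Unif_hom (ends_space Z) W"
    unfolding Unif_hom_def fst_ends_space mem_Collect_eq
  proof (intro conjI ballI)
    show "u \<in> ends Z \<rightarrow>\<^sub>E fst W"
    proof (rule PiE_I)
      fix p assume "p \<in> ends Z"
      then obtain i q where iq: "i \<in> I" "q \<in> ends (X i)" "p = inc_ends i q" by (rule inc_ends_surj)
      then have "g i q \<in> fst W" using g[OF iq(1)] by (auto simp: Unif_hom_def)
      then show "u p \<in> fst W" using u iq by simp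
    qed (simp add: u_def)
    fix D assume D: "D \<in> snd W"
    have "\<forall>i\<in>I. \<exists>\<U>. coarse_cover (X i) \<U> \<and>
        end_entourage (X i) \<U> \<subseteq> {(x, y) \<in> ends (X i) \<times> ends (X i). (g i x, g i y) \<in> D}"
    proof
      fix i assume "i \<in> I"
      then have "{(x, y) \<in> ends (X i) \<times> ends (X i). (g i x, g i y) \<in> D} \<in> snd (ends_space (X i))"
        using g D by (auto simp: Unif_hom_def)
      then show "\<exists>\<U>. coarse_cover (X i) \<U> \<and>
        end_entourage (X i) \<U> \<subseteq> {(x, y) \<in> ends (X i) \<times> ends (X i). (g i x, g i y) \<in> D}"
        unfolding snd_ends_space by blast
    qed
    then obtain \<U> where "\<forall>i\<in>I. coarse_cover (X i) (\<U> i) \<and>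
        end_entourage (X i) (\<U> i) \<subseteq> {(x, y) \<in> ends (X i) \<times> ends (X i). (g i x, g i y) \<in> D}"
      by (elim bchoice[THEN exE])
    then have \<U>: "\<And>i. i \<in> I \<Longrightarrow> coarse_cover (X i) (\<U> i)"
      and \<U>D: "\<And>i. i \<in> I \<Longrightarrow> end_entourage (X i) (\<U> i) \<subseteq> {(x, y) \<in> ends (X i) \<times> ends (X i). (g i x, g i y) \<in> D}"
      by simp_all
    let ?\<W> = "\<Union>i\<in>I. (`) (inc i) ` \<U> i"
    have "(u p, u q) \<in> D" if pq: "(p, q) \<in> end_entourage Z ?\<W>" for p q
    proof -
      obtain i p' q' where i: "i \<in> I" "(p', q') \<in> end_entourage (X i) (\<U> i)"
        and eq: "p = inc_ends i p'" "q = inc_ends i q'"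
        using end_entourage_inc_images[OF \<U> pq] by blast
      then have "(g i p', g i q') \<in> D" "p' \<in> ends (X i)" "q' \<in> ends (X i)" using \<U>D by auto
      then show ?thesis using u i(1) eq by simp
    qed
    then have "end_entourage Z ?\<W> \<subseteq> {(x, y) \<in> ends Z \<times> ends Z. (u x, u y) \<in> D}"
      using end_entourage_subset by fastforce
    then show "{(x, y) \<in> ends Z \<times> ends Z. (u x, u y) \<in> D} \<in> snd (ends_space Z)"
      using coarse_cover_inc_images[OF \<U>] unfolding snd_ends_space by blast
  qed
  with u show ?thesis using that by blast
qed

end

text \<open>
  The obvious carrier is \<open>{(i, x). i \<in> I, x \<in> X i}\<close>. As the universal property only tests against
  spaces with points in \<open>'a\<close>, its metric is transported along an injection of \<open>I \<times> UNIV\<close>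
  into \<open>'a\<close>, which exists for infinite \<open>'a\<close>.
\<close>

lemma metric_coproduct_exists:
  fixes X :: "'i \<Rightarrow> 'a metric"
  assumes I: "finite I" and inf: "infinite (UNIV :: 'a set)"
  shows "\<exists>(Z :: 'a metric) inc b. metric_coproduct I X Z inc b"
proof -
  obtain m :: "'a \<times> 'a \<Rightarrow> 'a" where m: "inj m"
    using card_of_ordIso[THEN iffD2, OF card_of_Times_same_infinite[OF inf]] by (auto simp: bij_betw_def)
  obtain n :: "'i \<Rightarrow> 'a" where n: "inj_on n I"
    using finite_lepoll_infinite[OF inf I] by (auto simp: lepoll_def)
  define e where "e = (\<lambda>(i, x). m (n i, x))"
  have e: "inj_on e (I \<times> UNIV)"
    unfolding e_def by (rule inj_onI) (auto dest!: injD[OF m] dest: inj_onD[OF n])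
  define b where "b i = (SOME x. x \<in> mspace (X i))" for i
  define P where "P = Sigma I (\<lambda>i. mspace (X i))"
  define D where "D = (\<lambda>(i, x) (j, y). if i = j then mdist (X i) x y
      else mdist (X i) (b i) x + 1 + mdist (X j) (b j) y)"
  define dec where "dec = inv_into (I \<times> UNIV) e"
  have base: "b i \<in> mspace (X i)" if "mspace (X i) \<noteq> {}" for i
    using that unfolding b_def by (simp add: some_in_eq)
  have dec: "dec (e (i, x)) = (i, x)" if "i \<in> I" for i x
    unfolding dec_def by (rule inv_into_f_f[OF e]) (use that in auto)
  have D_metric: "Metric_space P D"
  proof
    show "0 \<le> D p q" for p q by (auto simp: D_def split: prod.splits)
    show "D p q = D q p" for p q by (auto simp: D_def mdist_commute split: prod.splits)
    show "D p q = 0 \<longleftrightarrow> p = q" if pq: "p \<in> P" "q \<in> P" for p q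
    proof -
      obtain i x j y where *: "p = (i, x)" "q = (j, y)" by (metis surj_pair)
      have "0 < mdist (X i) (b i) x + 1 + mdist (X j) (b j) y"
        using mdist_nonneg[of "X i" "b i" x] mdist_nonneg[of "X j" "b j" y] by linarith
      then show ?thesis using pq by (auto simp: * D_def P_def)
    qed
    show "D p r \<le> D p q + D q r" if pqr: "p \<in> P" "q \<in> P" "r \<in> P" for p q r
    proof -
      obtain i x j y k z where *: "p = (i, x)" "q = (j, y)" "r = (k, z)" by (metis surj_pair)
      have in_X: "x \<in> mspace (X i)" "y \<in> mspace (X j)" "z \<in> mspace (X k)" using pqr by (auto simp: * P_def)
      then have bs: "b i \<in> mspace (X i)" "b j \<in> mspace (X j)" "b k \<in> mspace (X k)" using base by blast+
      have t1: "mdist (X i) x z \<le> mdist (X i) x y + mdist (X i) y z" if "i = j" "j = k"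
        using that in_X by (auto intro: mdist_triangle)
      have t2: "mdist (X i) (b i) x \<le> mdist (X i) (b i) y + mdist (X i) x y" if "i = j"
        using that in_X bs mdist_triangle[of "b i" "X i" y x] by (auto simp: mdist_commute[of _ x])
      have t3: "mdist (X k) (b k) z \<le> mdist (X k) (b k) y + mdist (X k) y z" if "j = k"
        using that in_X bs mdist_triangle[of "b k" "X k" y z] by auto
      have t4: "mdist (X i) x z \<le> mdist (X i) (b i) x + mdist (X i) (b i) z" if "i = k"
        using that in_X bs mdist_triangle[of x "X i" "b i" z] by (auto simp: mdist_commute[of _ x])
      have nn: "0 \<le> mdist (X i) (b i) x" "0 \<le> mdist (X j) (b j) y" "0 \<le> mdist (X k) (b k) z" by auto
      show ?thesis
      proof (cases "i = k \<and> j \<noteq> k")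
        case True
        then have ik: "i = k" and jk: "k \<noteq> j" by auto
        have "mdist (X k) x z \<le> (mdist (X k) (b k) x + 1 + mdist (X j) (b j) y) +
            (mdist (X j) (b j) y + 1 + mdist (X k) (b k) z)"
          using t4[OF ik] nn unfolding ik by linarith
        then show ?thesis using jk by (simp add: * D_def ik)
      next
        case False
        then show ?thesis using t1 t2 t3 nn unfolding * D_def by auto
      qed
    qed
  qed
  interpret D: Metric_space P D by (rule D_metric)
  have decP: "dec u \<in> P" if u: "u \<in> e ` P" for u
    using u dec by (auto simp: P_def)
  have dec_eq: "dec u = dec v \<longleftrightarrow> u = v" if uv: "u \<in> e ` P" "v \<in> e ` P" for u v
    using uv dec by (auto simp: P_def)
  have Z: "Metric_space (e ` P) (\<lambda>u v. D (dec u) (dec v))"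
  proof
    show "0 \<le> D (dec u) (dec v)" for u v by simp
    show "D (dec u) (dec v) = D (dec v) (dec u)" for u v by (rule D.commute)
    show "D (dec u) (dec v) = 0 \<longleftrightarrow> u = v" if "u \<in> e ` P" "v \<in> e ` P" for u v
      using that decP dec_eq by simp
    show "D (dec u) (dec w) \<le> D (dec u) (dec v) + D (dec v) (dec w)"
      if "u \<in> e ` P" "v \<in> e ` P" "w \<in> e ` P" for u v w
      using that decP by (intro D.triangle) auto
  qed
  define Z where "Z = metric (e ` P, \<lambda>u v. D (dec u) (dec v))"
  have mZ: "mspace Z = e ` P" "mdist Z = (\<lambda>u v. D (dec u) (dec v))"
    using Metric_space.mspace_metric[OF Z] Metric_space.mdist_metric[OF Z] by (simp_all add: Z_def)
  have "metric_coproduct I X Z (\<lambda>i x. e (i, x)) b"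
  proof
    show "mspace Z = (\<Union>i\<in>I. (\<lambda>x. e (i, x)) ` mspace (X i))" by (auto simp: mZ P_def)
  qed (use I base in \<open>auto simp: mZ dec D_def\<close>)
  then show ?thesis by blast
qed

section \<open>Comparison with an arbitrary coproduct\<close>

lemma ends_empty_if_finite:
  assumes "finite (UNIV :: 'a set)"
  shows "ends (X :: 'a metric) = {}"
proof -
  have False if \<phi>: "coarse_ray X \<phi>" for \<phi>
    using coarse_ray_unbounded[OF \<phi>] coarse_bounded_finite[OF _ coarse_ray_subset[OF \<phi>]]
      finite_subset[OF subset_UNIV assms] by blast
  then show ?thesis by (auto elim: endsE)
qed

theorem lemma39:
  fixes I :: "'i set"
    and X :: "'i \<Rightarrow> 'u metric"
    and C :: "'u metric"
    and \<iota> :: "'i \<Rightarrow> ('u \<Rightarrow> 'u) set"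
  assumes "finite I"
    and "mCoarse_coproduct I X C \<iota>"
  shows "Unif_coproduct TYPE('v) I (\<lambda>i. ends_space (X i)) (ends_space C)
           (\<lambda>i. ends_map (X i) C (\<iota> i))"
proof -
  have \<iota>_hom: "\<forall>i\<in>I. \<iota> i \<in> mCoarse_hom (X i) C"
    and univ: "\<And>(Y :: 'u metric) G. (\<And>i. i \<in> I \<Longrightarrow> G i \<in> mCoarse_hom (X i) Y) \<Longrightarrow>
        \<exists>!H. H \<in> mCoarse_hom C Y \<and> (\<forall>i\<in>I. mCoarse_comp (X i) Y H (\<iota> i) = G i)"
    using assms(2) unfolding mCoarse_coproduct_def by auto
  have "\<forall>i\<in>I. \<exists>f. coarse_map (X i) C f \<and> \<iota> i = coarse_class (X i) C f"
    using \<iota>_hom mCoarse_homE by metis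
  then obtain f where f: "\<And>i. i \<in> I \<Longrightarrow> coarse_map (X i) C (f i)"
    and \<iota>: "\<And>i. i \<in> I \<Longrightarrow> \<iota> i = coarse_class (X i) C (f i)"
    by (metis bchoice)
  have "\<exists>!h. h \<in> Unif_hom (ends_space C) W \<and>
      (\<forall>i\<in>I. compose (ends (X i)) h (ends_map (X i) C (\<iota> i)) = g i)"
    if g: "\<forall>i\<in>I. g i \<in> Unif_hom (ends_space (X i)) W" for W :: "'v unif" and g
  proof (cases "finite (UNIV :: 'u set)")
    case True
    then have empty: "ends Y = {}" for Y :: "'u metric" by (rule ends_empty_if_finite)
    have hom: "h \<in> Unif_hom (ends_space Y) W \<longleftrightarrow> h = (\<lambda>_. undefined)" for Y :: "'u metric" and h
      using coarse_cover_whole[of Y] by (auto simp: Unif_hom_def empty snd_ends_space end_entourage_def)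
    then have "g i = (\<lambda>_. undefined)" if "i \<in> I" for i using g that by blast
    then show ?thesis by (auto simp: hom empty compose_def restrict_def fun_eq_iff)
  next
    case False
    then obtain Z :: "'u metric" and inc b where "metric_coproduct I X Z inc b"
      using metric_coproduct_exists[OF assms(1)] by blast
    then interpret metric_coproduct I X Z inc b .
    obtain H where H: "H \<in> mCoarse_hom C Z"
      "\<forall>i\<in>I. mCoarse_comp (X i) Z H (\<iota> i) = coarse_class (X i) Z (inc i)"
      using univ[of "\<lambda>i. coarse_class (X i) Z (inc i)" Z] coarse_class_in_hom[OF coarse_map_inc] by blast
    obtain h where h: "coarse_map C Z h" "H = coarse_class C Z h" using H(1) by (rule mCoarse_homE)
    have h_inc: "coarse_class (X i) Z (h \<circ> f i) = coarse_class (X i) Z (inc i)" if "i \<in> I" for i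
      using bspec[OF H(2) that] unfolding \<iota>[OF that] h(2) mCoarse_comp_class[OF f[OF that] h(1)] .
    obtain k where k: "coarse_map Z C k" "\<And>i x. i \<in> I \<Longrightarrow> x \<in> mspace (X i) \<Longrightarrow> k (inc i x) = f i x"
      using coarse_copairing[of C f] f by blast
    have k_inc: "coarse_class (X i) C (k \<circ> inc i) = coarse_class (X i) C (f i)" if i: "i \<in> I" for i
    proof -
      have "f i x \<in> mspace C" if "x \<in> mspace (X i)" for x
        using f[OF i] that by (auto simp: coarse_map_def)
      then have "\<forall>x\<in>mspace (X i). mdist C ((k \<circ> inc i) x) (f i x) \<le> 0"
        using k(2)[OF i] by simp
      then show ?thesis
        unfolding coarse_class_eq_iff[OF coarse_map_compose[OF coarse_map_inc[OF i] k(1)] f[OF i]] mem_closeness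
        using coarse_map_compose[OF coarse_map_inc[OF i] k(1)] f[OF i] by blast
    qed
    have "(k \<circ> (h \<circ> f i), k \<circ> inc i) \<in> closeness (X i) C" if i: "i \<in> I" for i
      using h_inc[OF i] coarse_class_eq_iff[OF coarse_map_compose[OF f[OF i] h(1)] coarse_map_inc[OF i]]
        closeness_compose closeness_refl[OF k(1)] by blast
    then have kh_f: "coarse_class (X i) C ((k \<circ> h) \<circ> f i) = coarse_class (X i) C (f i)" if i: "i \<in> I" for i
      using k_inc[OF i] i coarse_class_eq_iff coarse_map_compose f h(1) k(1) coarse_map_inc
      by (metis comp_assoc)
    have kh: "coarse_map C C (k \<circ> h)" using h(1) k(1) by (rule coarse_map_compose)
    \<comment> \<open>Both \<open>k \<circ> h\<close> and the identity are mediating maps from \<open>C\<close> to itself.\<close>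
    have "\<forall>i\<in>I. mCoarse_comp (X i) C (coarse_class C C (k \<circ> h)) (\<iota> i) = \<iota> i"
      using mCoarse_comp_class[OF f kh] kh_f \<iota> by simp
    moreover have "\<forall>i\<in>I. mCoarse_comp (X i) C (coarse_class C C id) (\<iota> i) = \<iota> i"
      using mCoarse_comp_class[OF f coarse_map_id] \<iota> by simp
    moreover have "\<exists>!H. H \<in> mCoarse_hom C C \<and> (\<forall>i\<in>I. mCoarse_comp (X i) C H (\<iota> i) = \<iota> i)"
      using \<iota>_hom by (intro univ) blast
    moreover have "F = G" if "\<exists>!H. P H" "P F" "P G" for P and F G :: "('u \<Rightarrow> 'u) set"
      using that by blast
    ultimately have kh_id: "coarse_class C C (k \<circ> h) = coarse_class C C id"
      using coarse_class_in_hom[OF kh] coarse_class_in_hom[OF coarse_map_id] by (metis (mono_tags, lifting))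
    \<comment> \<open>Passing to ends turns the relations up to closeness into equations between maps.\<close>
    let ?f = "\<lambda>i. ends_map (X i) C (\<iota> i)" and ?h = "ends_map C Z (coarse_class C Z h)"
      and ?k = "ends_map Z C (coarse_class Z C k)"
    have hf: "?h (?f i q) = inc_ends i q" if "i \<in> I" "q \<in> ends (X i)" for i q
      using ends_map_compose[OF f h(1)] \<iota> h_inc that by simp
    have kinc: "?k (inc_ends i q) = ?f i q" if "i \<in> I" "q \<in> ends (X i)" for i q
      using ends_map_compose[OF coarse_map_inc k(1)] \<iota> k_inc that by simp
    have khp: "?k (?h p) = p" if "p \<in> ends C" for p
      using ends_map_compose[OF h(1) k(1) that] kh_id ends_map_id[OF that] by simp
    have surj: "\<exists>i\<in>I. \<exists>q\<in>ends (X i). p = ?f i q" if p: "p \<in> ends C" for p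
    proof -
      have "?h p \<in> ends Z" using ends_map_in_ends[OF h(1) p] .
      then obtain i q where iq: "i \<in> I" "q \<in> ends (X i)" "?h p = inc_ends i q" by (rule inc_ends_surj)
      then have "p = ?f i q" using khp[OF p] kinc by simp
      with iq show ?thesis by blast
    qed
    obtain u where u: "u \<in> Unif_hom (ends_space Z) W"
      "\<And>i q. i \<in> I \<Longrightarrow> q \<in> ends (X i) \<Longrightarrow> u (inc_ends i q) = g i q"
      using Unif_copairing[of g W] g by blast
    have g_ext: "g i q = undefined" if "i \<in> I" "q \<notin> ends (X i)" for i q
      using g that by (auto simp: Unif_hom_def PiE_def extensional_def)
    have f_in: "?f i q \<in> ends C" if "i \<in> I" "q \<in> ends (X i)" for i q
      using ends_map_in_ends[OF f] \<iota> that by simp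
    show ?thesis
    proof (rule ex1I[of _ "compose (ends C) u ?h"], intro conjI ballI)
      show "compose (ends C) u ?h \<in> Unif_hom (ends_space C) W"
        using Unif_hom_compose[OF ends_map_in_Unif_hom[OF h(1)] u(1)] by simp
      show "compose (ends (X i)) (compose (ends C) u ?h) (?f i) = g i" if i: "i \<in> I" for i
      proof
        show "compose (ends (X i)) (compose (ends C) u ?h) (?f i) q = g i q" for q
          using g_ext[OF i, of q] hf[OF i] u(2)[OF i] f_in[OF i] by (simp add: compose_def)
      qed
    next
      fix v assume v: "v \<in> Unif_hom (ends_space C) W \<and> (\<forall>i\<in>I. compose (ends (X i)) v (?f i) = g i)"
      show "v = compose (ends C) u ?h"
      proof
        fix p
        show "v p = compose (ends C) u ?h p"
        proof (cases "p \<in> ends C")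
          case True
          then obtain i q where iq: "i \<in> I" "q \<in> ends (X i)" "p = ?f i q" using surj by blast
          then have "v p = compose (ends (X i)) v (?f i) q" by (simp add: compose_def)
          also have "\<dots> = g i q" using v iq(1) by simp
          finally show ?thesis using True hf[OF iq(1,2)] u(2)[OF iq(1,2)] iq(3) by (simp add: compose_def)
        next
          case False
          then show ?thesis using v by (auto simp: Unif_hom_def PiE_def extensional_def compose_def)
        qed
      qed
    qed
  qed
  then show ?thesis
    unfolding Unif_coproduct_def
    using uniform_structure_ends_space ends_map_in_Unif_hom[OF f] \<iota> by auto
qed

end
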